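(* Suppose the doubling metric measure space $(X,\rho,\mu)$ admits a measurable differentiable structure such that for each chart $(X_\alpha,\{x_\alpha^j\}_{j=1}^{N_\alpha})$ the partial derivatives $f\mapsto\frac{\partial f}{\partial x_\alpha^j}$, $j=1,\dots,N_\alpha$, are derivations, i.e. belong to $\mathrm{Der}(X_\alpha,\mu)$. Let $M\in\mathbb{N}\cup\{\infty\}$ and let $\{g_j\}_{j=1}^M$ be a generating set for the Lipschitz algebra $\mathrm{Lip}^\infty(X)$. Then the charts can be chosen so that the chart functions belong to $\{g_j\}_{j=1}^M$; that is, $X$ admits a measurable differentiable structure all of whose chart functions belong to $\{g_j\}_{j=1}^M$.
   Context: Doubling metric measure space: a metric space $(X,\rho)$ with a Borel measure $\mu$ for which there is $C$ with $0<\mu(B(x,2r))\le C\mu(B(x,r))<\infty$ for all $x\in X$, $r>0$. $\mathrm{Lip}^\infty(X)$ is the real algebra of bounded Lipschitz functions $X\to\mathbb{R}$ with norm $\|f\|=\max(\sup|f|,\mathbf{L}(f))$, where $\mathbf{L}(f)$ is the global Lipschitz constant. It is a dual Banach space with unique predual (the closed linear span of the point evaluations in $\mathrm{Lip}^\infty(X)^*$), giving its weak* topology; a sequence $f_n$ converges weak* to $f$ iff $\sup_n\|f_n\|<\infty$ and $f_n\to f$ pointwise. A subset of $\mathrm{Lip}^\infty(X)$ is a generating set if the subalgebra generated by it is weak* dense in $\mathrm{Lip}^\infty(X)$. A derivation is a bounded linear map $D:\mathrm{Lip}^\infty(X)\to L^\infty(X,\mu)$ with $D(fg)=(Df)g+f(Dg)$,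 such that $f_n\to f$ weak* in $\mathrm{Lip}^\infty(X)$ implies $Df_n\to Df$ weak* in $L^\infty(X,\mu)$ (dual of $L^1(X,\mu)$). For measurable $U\subset X$ with $\mu(U)>0$, $\mathrm{Der}(U,\mu)$ is the $L^\infty(U,\mu)$-module of derivations $\mathrm{Lip}^\infty(U)\to L^\infty(U,\mu)$ of $U$ with the restricted metric and measure. For a Lipschitz function $f$, $$\mathrm{Lip}f(x)=\inf_{r>0}\ \sup_{0<s\le r}\ \frac1s\sup_{y\in B(x,s)}|f(x)-f(y)|.$$ $X$ has a measurable differentiable structure if there are a countable measurable partition (up to a null set) $X=\bigcup_\alpha X_\alpha\cup\Omega$, $\mu(\Omega)=0$, and for each $\alpha$ a non-negative integer $N_\alpha$ and Lipschitz functions (chart functions) $x_\alpha^1,\dots,x_\alpha^{N_\alpha}$ such that for each Lipschitz function $f:X\to\mathbb{R}$ there are unique functions (partial derivatives) $\frac{\partial f}{\partial x_\alpha^j}\in L^\infty(X_\alpha,\mu)$ with $$\mathrm{Lip}\Big(f-\sum_{j=1}^{N_\alpha}\frac{\partial f}{\partial x_\alpha^j}(x)\,x_\alpha^j\Big)(x)=0\quad\text{for a.e. }x\in X_\alpha$$ (for fixed $x$ the coefficients are constants), and the integers $N_\alpha$ are uniformly bounded. The pairs $(X_\alpha,\{x_\alpha^j\})$ are the charts. For $f\in\mathrm{Lip}^\infty(X_\alpha)$, the partial derivatives of $f$ are those of any Lipschitz extension of $f$ to $X$ (a.e. independent of the extension, as $\mu$ is doubling). *)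

theory Defs
  imports "HOL-Analysis.Analysis" "HOL-Probability.Essential_Supremum"
begin

definition doubling_measure :: "'a::metric_space measure \<Rightarrow> bool" where
  "doubling_measure \<mu> \<longleftrightarrow> sets \<mu> = sets borel \<and>
     (\<exists>C::real. \<forall>x. \<forall>r>0. 0 < emeasure \<mu> (ball x (2 * r)) \<and>
        emeasure \<mu> (ball x (2 * r)) \<le> ennreal C * emeasure \<mu> (ball x r) \<and>
        ennreal C * emeasure \<mu> (ball x r) < \<infinity>)"


section \<open>The Lipschitz algebra of a subset and its weak* topology\<close>

text \<open>
  A function on a subset \<open>U\<close> of the ambient space is encoded as the function on the whole type that
  extends it by zero; pointwise operations and equality of such functions are those of functions
  on \<open>U\<close>. The Lipschitz condition concerns points of \<open>U\<close> only. For \<open>U = UNIV\<close> the encoding is void.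
\<close>

definition lip_algebra :: "'a::metric_space set \<Rightarrow> ('a \<Rightarrow> real) set" where
  "lip_algebra U = {f. (\<exists>L. L-lipschitz_on U f) \<and> bounded (f ` U) \<and> (\<forall>x. x \<notin> U \<longrightarrow> f x = 0)}"

definition lip_const :: "'a::metric_space set \<Rightarrow> ('a \<Rightarrow> real) \<Rightarrow> real" where
  "lip_const U f = Inf {L. L-lipschitz_on U f}"

definition lip_norm :: "'a::metric_space set \<Rightarrow> ('a \<Rightarrow> real) \<Rightarrow> real" where
  "lip_norm U f = max (SUP x\<in>U. \<bar>f x\<bar>) (lip_const U f)"

text \<open>Functionals matter only through their values on \<^term>\<open>lip_algebra U\<close>.\<close>

definition lip_dual :: "'a::metric_space set \<Rightarrow> (('a \<Rightarrow> real) \<Rightarrow> real) set" where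
  "lip_dual U = {\<phi>.
     (\<forall>f\<in>lip_algebra U. \<forall>g\<in>lip_algebra U. \<phi> (\<lambda>x. f x + g x) = \<phi> f + \<phi> g) \<and>
     (\<forall>f\<in>lip_algebra U. \<forall>c. \<phi> (\<lambda>x. c * f x) = c * \<phi> f) \<and>
     (\<exists>C. \<forall>f\<in>lip_algebra U. \<bar>\<phi> f\<bar> \<le> C * lip_norm U f)}"

text \<open>
  The predual: the closure, in the dual norm, of the linear span of the point evaluations at points
  of \<open>U\<close>. A bound \<open>e\<close> on the dual norm of a functional is spelled out as the inequality it means.
\<close>

definition lip_predual :: "'a::metric_space set \<Rightarrow> (('a \<Rightarrow> real) \<Rightarrow> real) set" where
  "lip_predual U = {\<phi> \<in> lip_dual U. \<forall>e>0. \<exists>F c. finite F \<and> F \<subseteq> U \<and>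
     (\<forall>f\<in>lip_algebra U. \<bar>\<phi> f - (\<Sum>p\<in>F. c p * f p)\<bar> \<le> e * lip_norm U f)}"

definition lip_weak_star :: "'a::metric_space set \<Rightarrow> ('a \<Rightarrow> real) topology" where
  "lip_weak_star U =
     topology_generated_by {{f \<in> lip_algebra U. \<phi> f \<in> S} | \<phi> S. \<phi> \<in> lip_predual U \<and> open S}"

text \<open>Subalgebras of the unital algebra of bounded Lipschitz functions contain the constants.\<close>

inductive_set generated_subalgebra :: "('a \<Rightarrow> real) set \<Rightarrow> ('a \<Rightarrow> real) set"
  for G :: "('a \<Rightarrow> real) set" where
  const: "(\<lambda>_. c) \<in> generated_subalgebra G"
| gen: "g \<in> G \<Longrightarrow> g \<in> generated_subalgebra G"
| add: "\<lbrakk>f \<in> generated_subalgebra G; h \<in> generated_subalgebra G\<rbrakk>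
    \<Longrightarrow> (\<lambda>x. f x + h x) \<in> generated_subalgebra G"
| mult: "\<lbrakk>f \<in> generated_subalgebra G; h \<in> generated_subalgebra G\<rbrakk>
    \<Longrightarrow> (\<lambda>x. f x * h x) \<in> generated_subalgebra G"

definition generating_set :: "('a::metric_space \<Rightarrow> real) set \<Rightarrow> bool" where
  "generating_set G \<longleftrightarrow> G \<subseteq> lip_algebra UNIV \<and>
     lip_weak_star UNIV closure_of generated_subalgebra G = lip_algebra UNIV"


section \<open>Derivations\<close>

text \<open>
  Elements of the space of essentially bounded functions are given by representatives, and
  equalities between them are equalities almost everywhere.
\<close>

definition Linf_norm :: "'a measure \<Rightarrow> ('a \<Rightarrow> real) \<Rightarrow> ereal" where
  "Linf_norm \<nu> f = esssup \<nu> (\<lambda>p. ereal \<bar>f p\<bar>)"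

definition Linf :: "'a measure \<Rightarrow> ('a \<Rightarrow> real) set" where
  "Linf \<nu> = {f \<in> borel_measurable \<nu>. Linf_norm \<nu> f < \<infinity>}"

definition Linf_weak_star_lim :: "'a measure \<Rightarrow> (nat \<Rightarrow> 'a \<Rightarrow> real) \<Rightarrow> ('a \<Rightarrow> real) \<Rightarrow> bool" where
  "Linf_weak_star_lim \<nu> fs f \<longleftrightarrow>
     (\<forall>h. integrable \<nu> h \<longrightarrow> (\<lambda>n. \<integral>p. fs n p * h p \<partial>\<nu>) \<longlonglongrightarrow> (\<integral>p. f p * h p \<partial>\<nu>))"

definition Der :: "'a::metric_space measure \<Rightarrow> 'a set \<Rightarrow> (('a \<Rightarrow> real) \<Rightarrow> 'a \<Rightarrow> real) set" where
  "Der \<mu> U = {D.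
     (\<forall>f\<in>lip_algebra U. D f \<in> Linf (restrict_space \<mu> U)) \<and>
     (\<forall>f\<in>lip_algebra U. \<forall>g\<in>lip_algebra U.
        AE p in restrict_space \<mu> U. D (\<lambda>x. f x + g x) p = D f p + D g p) \<and>
     (\<forall>f\<in>lip_algebra U. \<forall>c.
        AE p in restrict_space \<mu> U. D (\<lambda>x. c * f x) p = c * D f p) \<and>
     (\<exists>C. \<forall>f\<in>lip_algebra U.
        Linf_norm (restrict_space \<mu> U) (D f) \<le> ereal (C * lip_norm U f)) \<and>
     (\<forall>f\<in>lip_algebra U. \<forall>g\<in>lip_algebra U.
        AE p in restrict_space \<mu> U. D (\<lambda>x. f x * g x) p = D f p * g p + f p * D g p) \<and>
     (\<forall>fs f. (\<forall>n. fs n \<in> lip_algebra U) \<longrightarrow> limitin (lip_weak_star U) fs f sequentially \<longrightarrow>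
        Linf_weak_star_lim (restrict_space \<mu> U) (\<lambda>n. D (fs n)) (D f))}"


section \<open>Measurable differentiable structures\<close>

definition pointwise_Lip :: "('a::metric_space \<Rightarrow> real) \<Rightarrow> 'a \<Rightarrow> ennreal" where
  "pointwise_Lip f x =
     (INF r\<in>{0<..}. SUP s\<in>{0<..r}. ennreal (1 / s) * (SUP y\<in>ball x s. ennreal \<bar>f x - f y\<bar>))"

text \<open>
  \<open>d 0, \<dots>, d (n - 1)\<close> are partial derivatives on \<open>A\<close> of \<open>f\<close> with respect to the chart functions
  \<open>x 0, \<dots>, x (n - 1)\<close>. The coefficients are frozen at \<open>p\<close>; the pointwise Lipschitz constant is
  taken in the whole space, not in \<open>A\<close>.
\<close>

definition partials ::
  "'a::metric_space measure \<Rightarrow> 'a set \<Rightarrow> nat \<Rightarrow> (nat \<Rightarrow> 'a \<Rightarrow> real) \<Rightarrow> ('a \<Rightarrow> real) \<Rightarrow>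
    (nat \<Rightarrow> 'a \<Rightarrow> real) \<Rightarrow> bool" where
  "partials \<mu> A n x f d \<longleftrightarrow>
     (\<forall>j<n. d j \<in> Linf (restrict_space \<mu> A)) \<and>
     (AE p in restrict_space \<mu> A. pointwise_Lip (\<lambda>y. f y - (\<Sum>j<n. d j p * x j y)) p = 0)"

definition chart ::
  "'a::metric_space measure \<Rightarrow> 'a set \<Rightarrow> nat \<Rightarrow> (nat \<Rightarrow> 'a \<Rightarrow> real) \<Rightarrow> bool" where
  "chart \<mu> A n x \<longleftrightarrow>
     (\<forall>j<n. \<exists>L. L-lipschitz_on UNIV (x j)) \<and>
     (\<forall>f. (\<exists>L. L-lipschitz_on UNIV f) \<longrightarrow>
        (\<exists>d. partials \<mu> A n x f d \<and>
           (\<forall>d'. partials \<mu> A n x f d' \<longrightarrow>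
              (\<forall>j<n. AE p in restrict_space \<mu> A. d' j p = d j p))))"

text \<open>The countable family of charts is indexed by a set \<open>I\<close> of natural numbers.\<close>

definition measurable_diff_structure ::
  "'a::metric_space measure \<Rightarrow> nat set \<Rightarrow> (nat \<Rightarrow> 'a set) \<Rightarrow> (nat \<Rightarrow> nat) \<Rightarrow>
    (nat \<Rightarrow> nat \<Rightarrow> 'a \<Rightarrow> real) \<Rightarrow> bool" where
  "measurable_diff_structure \<mu> I X N x \<longleftrightarrow>
     (\<forall>\<alpha>\<in>I. X \<alpha> \<in> sets \<mu>) \<and> disjoint_family_on X I \<and>
     UNIV - (\<Union>\<alpha>\<in>I. X \<alpha>) \<in> null_sets \<mu> \<and>
     (\<forall>\<alpha>\<in>I. chart \<mu> (X \<alpha>) (N \<alpha>) (x \<alpha>)) \<and>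
     (\<exists>B. \<forall>\<alpha>\<in>I. N \<alpha> \<le> B)"

text \<open>
  The partial derivatives of a bounded Lipschitz function on \<open>A\<close> are those of any Lipschitz
  extension to the whole space; they are determined up to null sets, so that the maps they define
  are derivations if and only if some choice \<open>D\<close> of representatives is.
\<close>

definition partials_are_derivations ::
  "'a::metric_space measure \<Rightarrow> 'a set \<Rightarrow> nat \<Rightarrow> (nat \<Rightarrow> 'a \<Rightarrow> real) \<Rightarrow> bool" where
  "partials_are_derivations \<mu> A n x \<longleftrightarrow>
     (\<exists>D. (\<forall>f\<in>lip_algebra A. \<forall>F. (\<exists>L. L-lipschitz_on UNIV F) \<and> (\<forall>p\<in>A. F p = f p) \<longrightarrow>
             partials \<mu> A n x F (\<lambda>j. D j f)) \<and>
          (\<forall>j<n. D j \<in> Der \<mu> A))"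

end

theory Submission
  imports Defs
begin

text \<open>
  The coordinates of a chart \<open>(A, x 0, \<dots>, x (n - 1))\<close> are traded one at a time for generators, as in the
  Steinitz exchange lemma. Write \<open>E j\<close> for the partial derivative with respect to \<open>x j\<close>, read as
  an operator on bounded Lipschitz functions of the whole space. Where \<open>E k g\<close> is bounded away from
  zero, \<open>x k\<close> can be expressed to first order through \<open>g\<close> and the other coordinates, so that
  replacing \<open>x k\<close> by \<open>g\<close> gives a chart again; its partial derivatives are combinations of the old
  ones with bounded coefficients, hence again derivations (\<open>derivation_chart_exchange\<close>). The sets
  where \<open>\<bar>E k g\<bar> \<ge> 1 / (i + 1)\<close>, for \<open>g\<close> among the generators and \<open>i\<close> a natural number, are
  countably many, and after \<open>n\<close> exchanges every coordinate is a generator.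

  It remains to see that these sets cover \<open>A\<close> up to a null set: almost everywhere on \<open>A\<close> some
  generator has a nonzero \<open>k\<close>-th partial derivative (\<open>some_generator_has_nonzero_partial\<close>). Let \<open>B\<close> be
  the part of \<open>A\<close> where \<open>E k\<close> kills all generators. By the Leibniz rule \<open>E k\<close> vanishes on \<open>B\<close> for all
  functions in the subalgebra that they generate, and by weak* density it vanishes on \<open>B\<close> for all
  bounded Lipschitz functions. But the \<open>k\<close>-th partial derivative of \<open>x k\<close> is \<open>1\<close>, so \<open>B\<close> is null.

  The density step needs care, because derivations are only sequentially weak* continuous while
  density is a topological notion. Testing \<open>E k\<close> against an integrable function gives a functional
  that is continuous along bounded pointwise convergent sequences. Such a functional belongs to the
  predual, hence is weak* continuous, as soon as the space is separable
  (\<open>in_lip_predual_if_bounded_pointwise_continuous\<close>): separability turns sequential continuity into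
  the estimate that the functional is small on the functions of the unit ball that vanish on a
  suitable finite set, and a Hahn-Banach extension of finitely many dimensions turns this estimate
  into an approximation by combinations of point evaluations. A space with a doubling measure is
  separable because its balls have positive finite measure.
\<close>

section \<open>The Lipschitz norm\<close>

lemma lip_algebraD:
  assumes "f \<in> lip_algebra U"
  obtains L K where "L-lipschitz_on U f" "\<And>p. p \<in> U \<Longrightarrow> \<bar>f p\<bar> \<le> K" "0 \<le> K"
proof -
  obtain L where L: "L-lipschitz_on U f" using assms by (auto simp: lip_algebra_def)
  obtain K where K: "\<forall>y\<in>f ` U. norm y \<le> K"
    using assms by (auto simp: lip_algebra_def bounded_iff)
  show thesis by (rule that[OF L, of "max K 0"]) (use K in force)+
qed

lemma lip_algebraI:
  assumes "L-lipschitz_on U f" "\<And>p. p \<in> U \<Longrightarrow> \<bar>f p\<bar> \<le> K" "\<And>p. p \<notin> U \<Longrightarrow> f p = 0"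
  shows "f \<in> lip_algebra U"
  using assms by (auto simp: lip_algebra_def bounded_iff)

lemma lip_algebra_add:
  assumes "f \<in> lip_algebra U" "g \<in> lip_algebra U"
  shows "(\<lambda>p. f p + g p) \<in> lip_algebra U"
proof -
  obtain L K where f: "L-lipschitz_on U f" "\<And>p. p \<in> U \<Longrightarrow> \<bar>f p\<bar> \<le> K"
    using lip_algebraD[OF assms(1)] by metis
  obtain L' K' where g: "L'-lipschitz_on U g" "\<And>p. p \<in> U \<Longrightarrow> \<bar>g p\<bar> \<le> K'"
    using lip_algebraD[OF assms(2)] by metis
  show ?thesis
  proof (rule lip_algebraI)
    show "(L + L')-lipschitz_on U (\<lambda>p. f p + g p)" using f g by (intro lipschitz_on_add)
    show "\<bar>f p + g p\<bar> \<le> K + K'" if "p \<in> U" for p using f(2)[OF that] g(2)[OF that] by linarith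
  qed (use assms in \<open>simp add: lip_algebra_def\<close>)
qed

lemma lip_algebra_mult:
  assumes "f \<in> lip_algebra U" "g \<in> lip_algebra U"
  shows "(\<lambda>p. f p * g p) \<in> lip_algebra U"
proof -
  obtain L K where f: "L-lipschitz_on U f" "\<And>p. p \<in> U \<Longrightarrow> \<bar>f p\<bar> \<le> K" "0 \<le> K"
    using lip_algebraD[OF assms(1)] by metis
  obtain L' K' where g: "L'-lipschitz_on U g" "\<And>p. p \<in> U \<Longrightarrow> \<bar>g p\<bar> \<le> K'" "0 \<le> K'"
    using lip_algebraD[OF assms(2)] by metis
  show ?thesis
  proof (rule lip_algebraI)
    show "(K * L' + K' * L)-lipschitz_on U (\<lambda>p. f p * g p)"
    proof (rule lipschitz_onI)
      fix p q assume pq: "p \<in> U" "q \<in> U"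
      have "f p * g p - f q * g q = f p * (g p - g q) + g q * (f p - f q)"
        by (simp add: algebra_simps)
      then have "\<bar>f p * g p - f q * g q\<bar> \<le> \<bar>f p\<bar> * \<bar>g p - g q\<bar> + \<bar>g q\<bar> * \<bar>f p - f q\<bar>"
        by (metis abs_mult abs_triangle_ineq)
      also have "\<dots> \<le> K * (L' * dist p q) + K' * (L * dist p q)"
        using f(2)[OF pq(1)] g(2)[OF pq(2)] lipschitz_onD[OF f(1) pq] lipschitz_onD[OF g(1) pq] f(3) g(3)
        by (intro add_mono mult_mono) (auto simp: dist_real_def)
      finally show "dist (f p * g p) (f q * g q) \<le> (K * L' + K' * L) * dist p q"
        by (simp add: dist_real_def algebra_simps)
    qed (use f g lipschitz_on_nonneg in \<open>metis add_nonneg_nonneg mult_nonneg_nonneg\<close>)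
    show "\<bar>f p * g p\<bar> \<le> K * K'" if "p \<in> U" for p
      using f(2)[OF that] g(2)[OF that] f(3) by (simp add: abs_mult mult_mono)
  qed (use assms in \<open>simp add: lip_algebra_def\<close>)
qed

lemma lip_algebra_scale:
  assumes "f \<in> lip_algebra U"
  shows "(\<lambda>p. c * f p) \<in> lip_algebra U"
proof -
  obtain L K where f: "L-lipschitz_on U f" "\<And>p. p \<in> U \<Longrightarrow> \<bar>f p\<bar> \<le> K" "0 \<le> K"
    using lip_algebraD[OF assms(1)] by metis
  show ?thesis
  proof (rule lip_algebraI)
    show "(\<bar>c\<bar> * L)-lipschitz_on U (\<lambda>p. c * f p)"
      using lipschitz_on_cmult_real[OF f(1)] by simp
    show "\<bar>c * f p\<bar> \<le> \<bar>c\<bar> * K" if "p \<in> U" for p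
      using f(2)[OF that] by (simp add: abs_mult mult_left_mono)
  qed (use assms in \<open>simp add: lip_algebra_def\<close>)
qed

lemma lip_algebra_const: "(\<lambda>_. c) \<in> lip_algebra UNIV"
  by (rule lip_algebraI[of 0 _ _ "\<bar>c\<bar>"]) (auto intro: lipschitz_on_constant)

lemma lip_norm_le:
  assumes "U \<noteq> {}" "c-lipschitz_on U f" "\<And>p. p \<in> U \<Longrightarrow> \<bar>f p\<bar> \<le> c"
  shows "lip_norm U f \<le> c"
proof -
  have "bdd_below {L. L-lipschitz_on U f}"
    by (rule bdd_belowI[of _ 0]) (auto dest: lipschitz_on_nonneg)
  then have "lip_const U f \<le> c"
    unfolding lip_const_def by (intro cInf_lower) (use assms in auto)
  moreover have "(SUP x\<in>U. \<bar>f x\<bar>) \<le> c" using assms by (intro cSUP_least) auto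
  ultimately show ?thesis by (simp add: lip_norm_def)
qed

lemma abs_le_lip_norm:
  assumes "f \<in> lip_algebra U" "p \<in> U"
  shows "\<bar>f p\<bar> \<le> lip_norm U f"
proof -
  obtain K where "\<And>p. p \<in> U \<Longrightarrow> \<bar>f p\<bar> \<le> K" using lip_algebraD[OF assms(1)] by metis
  then have "bdd_above ((\<lambda>x. \<bar>f x\<bar>) ` U)" by (auto simp: bdd_above_def)
  then have "\<bar>f p\<bar> \<le> (SUP x\<in>U. \<bar>f x\<bar>)" using assms by (intro cSUP_upper)
  then show ?thesis by (simp add: lip_norm_def)
qed

lemma lip_norm_nonneg: "f \<in> lip_algebra U \<Longrightarrow> U \<noteq> {} \<Longrightarrow> 0 \<le> lip_norm U f"
  using abs_le_lip_norm[of f U] by fastforce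

lemma dist_le_lip_norm:
  assumes "f \<in> lip_algebra U" "p \<in> U" "q \<in> U"
  shows "\<bar>f p - f q\<bar> \<le> lip_norm U f * dist p q"
proof (cases "p = q")
  case False
  have "\<bar>f p - f q\<bar> / dist p q \<le> lip_const U f"
    unfolding lip_const_def
  proof (rule cInf_greatest)
    show "{L. L-lipschitz_on U f} \<noteq> {}" using assms by (auto simp: lip_algebra_def)
    fix L assume "L \<in> {L. L-lipschitz_on U f}"
    then have "\<bar>f p - f q\<bar> \<le> L * dist p q" using assms by (auto dest: lipschitz_onD simp: dist_real_def)
    then show "\<bar>f p - f q\<bar> / dist p q \<le> L" using False by (simp add: divide_le_eq)
  qed
  also have "\<dots> \<le> lip_norm U f" by (simp add: lip_norm_def)
  finally show ?thesis using False by (simp add: divide_le_eq)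
qed simp

lemma lip_norm_lipschitz:
  assumes "f \<in> lip_algebra U" "U \<noteq> {}"
  shows "(lip_norm U f)-lipschitz_on U f"
  using assms by (intro lipschitz_onI) (auto simp: dist_real_def dist_le_lip_norm lip_norm_nonneg)

lemma lip_norm_add_le:
  assumes "f \<in> lip_algebra U" "g \<in> lip_algebra U" "U \<noteq> {}"
  shows "lip_norm U (\<lambda>p. f p + g p) \<le> lip_norm U f + lip_norm U g"
proof (rule lip_norm_le[OF assms(3)])
  show "(lip_norm U f + lip_norm U g)-lipschitz_on U (\<lambda>p. f p + g p)"
    using assms by (intro lipschitz_on_add lip_norm_lipschitz)
  show "\<bar>f p + g p\<bar> \<le> lip_norm U f + lip_norm U g" if "p \<in> U" for p
    using abs_le_lip_norm[OF assms(1) that] abs_le_lip_norm[OF assms(2) that] by linarith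
qed

lemma lip_norm_scale_le:
  assumes "f \<in> lip_algebra U" "U \<noteq> {}"
  shows "lip_norm U (\<lambda>p. c * f p) \<le> \<bar>c\<bar> * lip_norm U f"
proof (rule lip_norm_le[OF assms(2)])
  show "(\<bar>c\<bar> * lip_norm U f)-lipschitz_on U (\<lambda>p. c * f p)"
    using lipschitz_on_cmult_real[OF lip_norm_lipschitz[OF assms]] by simp
  show "\<bar>c * f p\<bar> \<le> \<bar>c\<bar> * lip_norm U f" if "p \<in> U" for p
    using abs_le_lip_norm[OF assms(1) that] by (simp add: abs_mult mult_left_mono)
qed

section \<open>Functionals in the predual\<close>

text \<open>
  One dimension of the Hahn-Banach theorem: on the functions that vanish on \<open>F\<close>, a multiple of the
  evaluation at \<open>q\<close> corrects \<open>\<phi>\<close> so that the bound known for functions vanishing at \<open>q\<close> as well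
  persists.
\<close>

lemma hahn_banach_step:
  fixes U :: "'a::metric_space set"
  assumes U: "U \<noteq> {}"
    and add: "\<And>f g. f \<in> lip_algebra U \<Longrightarrow> g \<in> lip_algebra U \<Longrightarrow> \<phi> (\<lambda>x. f x + g x) = \<phi> f + \<phi> g"
    and scale: "\<And>f c. f \<in> lip_algebra U \<Longrightarrow> \<phi> (\<lambda>x. c * f x) = c * \<phi> f"
    and bound: "\<And>f. f \<in> lip_algebra U \<Longrightarrow> \<forall>p\<in>insert q F. f p = 0 \<Longrightarrow> \<bar>\<phi> f\<bar> \<le> e * lip_norm U f"
    and e: "0 \<le> e"
  shows "\<exists>c. \<forall>f\<in>lip_algebra U. (\<forall>p\<in>F. f p = 0) \<longrightarrow> \<bar>\<phi> f - c * f q\<bar> \<le> e * lip_norm U f"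
proof -
  \<comment> \<open>By homogeneity only the functions with value \<open>1\<close> at \<open>q\<close> restrict \<open>c\<close>, each to an interval of
    radius \<open>e * lip_norm U f\<close> around \<open>\<phi> f\<close>.\<close>
  define V where "V = {f \<in> lip_algebra U. (\<forall>p\<in>F. f p = 0) \<and> f q = 1}"
  \<comment> \<open>These intervals intersect pairwise, because the difference of two such functions vanishes at \<open>q\<close>.\<close>
  have key: "\<phi> f - e * lip_norm U f \<le> \<phi> g + e * lip_norm U g" if "f \<in> V" "g \<in> V" for f g
  proof -
    have fg: "f \<in> lip_algebra U" "g \<in> lip_algebra U" using that by (auto simp: V_def)
    have g': "(\<lambda>x. (-1) * g x) \<in> lip_algebra U" using fg(2) by (rule lip_algebra_scale)
    have "\<bar>\<phi> (\<lambda>x. f x + (-1) * g x)\<bar> \<le> e * lip_norm U (\<lambda>x. f x + (-1) * g x)"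
      by (rule bound[OF lip_algebra_add[OF fg(1) g']]) (use that in \<open>auto simp: V_def\<close>)
    also have "\<dots> \<le> e * (lip_norm U f + \<bar>-1\<bar> * lip_norm U g)"
      using lip_norm_add_le[OF fg(1) g' U] lip_norm_scale_le[OF fg(2) U, of "-1"] e
      by (intro mult_left_mono) auto
    finally show ?thesis
      using add[OF fg(1) g'] scale[OF fg(2), of "-1"] by (simp add: algebra_simps)
  qed
  obtain c where c: "\<And>f. f \<in> V \<Longrightarrow> \<phi> f - e * lip_norm U f \<le> c \<and> c \<le> \<phi> f + e * lip_norm U f"
  proof (cases "V = {}")
    case True then show ?thesis using that[of 0] by blast
  next
    case False
    then obtain f0 where f0: "f0 \<in> V" by blast
    let ?c = "SUP f\<in>V. \<phi> f - e * lip_norm U f"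
    have "bdd_above ((\<lambda>f. \<phi> f - e * lip_norm U f) ` V)"
      using key[OF _ f0] by (auto simp: bdd_above_def)
    then have "\<phi> f - e * lip_norm U f \<le> ?c" if "f \<in> V" for f using that by (intro cSUP_upper)
    moreover have "?c \<le> \<phi> f + e * lip_norm U f" if "f \<in> V" for f
      using False key[OF _ that] by (intro cSUP_least)
    ultimately show ?thesis using that[of ?c] by blast
  qed
  show ?thesis
  proof (intro exI[of _ c] ballI impI)
    fix f assume f: "f \<in> lip_algebra U" "\<forall>p\<in>F. f p = 0"
    show "\<bar>\<phi> f - c * f q\<bar> \<le> e * lip_norm U f"
    proof (cases "f q = 0")
      case True then show ?thesis using bound[OF f(1)] f(2) by auto
    next
      case False
      let ?f = "\<lambda>x. (1 / f q) * f x"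
      have "?f \<in> V" using False f lip_algebra_scale[OF f(1), of "1 / f q"] by (simp add: V_def)
      then have "\<bar>\<phi> ?f - c\<bar> \<le> e * lip_norm U ?f" using c[of ?f] by linarith
      also have "\<dots> \<le> e * (\<bar>1 / f q\<bar> * lip_norm U f)"
        by (intro mult_left_mono lip_norm_scale_le f U e)
      also have "\<phi> ?f = \<phi> f / f q" using scale[OF f(1), of "1 / f q"] by simp
      finally have "\<bar>\<phi> f / f q - c\<bar> * \<bar>f q\<bar> \<le> e * lip_norm U f"
        using False by (simp add: field_simps)
      moreover have "\<bar>\<phi> f / f q - c\<bar> * \<bar>f q\<bar> = \<bar>(\<phi> f / f q - c) * f q\<bar>" by (simp only: abs_mult)
      moreover have "(\<phi> f / f q - c) * f q = \<phi> f - c * f q" using False by (simp add: algebra_simps)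
      ultimately show ?thesis by simp
    qed
  qed
qed

text \<open>
  The points of \<open>F\<close> are removed one by one, each contributing one coefficient; the bound \<open>e\<close> is not
  spoiled on the way.
\<close>

lemma approximation_by_evaluations:
  fixes U :: "'a::metric_space set"
  assumes "finite F" and U: "U \<noteq> {}"
    and "\<And>f g. f \<in> lip_algebra U \<Longrightarrow> g \<in> lip_algebra U \<Longrightarrow> \<phi> (\<lambda>x. f x + g x) = \<phi> f + \<phi> g"
    and "\<And>f c. f \<in> lip_algebra U \<Longrightarrow> \<phi> (\<lambda>x. c * f x) = c * \<phi> f"
    and "\<And>f. f \<in> lip_algebra U \<Longrightarrow> \<forall>p\<in>F. f p = 0 \<Longrightarrow> \<bar>\<phi> f\<bar> \<le> e * lip_norm U f"
    and e: "0 \<le> e"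
  shows "\<exists>c. \<forall>f\<in>lip_algebra U. \<bar>\<phi> f - (\<Sum>p\<in>F. c p * f p)\<bar> \<le> e * lip_norm U f"
  using assms(1,3-5)
proof (induction F arbitrary: \<phi> rule: finite_induct)
  case empty
  then show ?case by simp
next
  case (insert q F)
  obtain a where a: "\<And>f. f \<in> lip_algebra U \<Longrightarrow> \<forall>p\<in>F. f p = 0 \<Longrightarrow> \<bar>\<phi> f - a * f q\<bar> \<le> e * lip_norm U f"
    using hahn_banach_step[where \<phi> = \<phi> and q = q and F = F, OF U insert.prems e] by metis
  have "\<exists>c. \<forall>f\<in>lip_algebra U. \<bar>\<phi> f - a * f q - (\<Sum>p\<in>F. c p * f p)\<bar> \<le> e * lip_norm U f"
  proof (rule insert.IH)
    show "\<phi> (\<lambda>x. f x + g x) - a * (f q + g q) = \<phi> f - a * f q + (\<phi> g - a * g q)"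
      if "f \<in> lip_algebra U" "g \<in> lip_algebra U" for f g
      using insert.prems(1)[OF that] by (simp add: algebra_simps)
    show "\<phi> (\<lambda>x. k * f x) - a * (k * f q) = k * (\<phi> f - a * f q)" if "f \<in> lip_algebra U" for f k
      using insert.prems(2)[OF that] by (simp add: algebra_simps)
  qed (use a in blast)
  then obtain c where c: "\<forall>f\<in>lip_algebra U. \<bar>\<phi> f - a * f q - (\<Sum>p\<in>F. c p * f p)\<bar> \<le> e * lip_norm U f"
    by (elim exE)
  have "(\<Sum>p\<in>F. (c(q := a)) p * f p) = (\<Sum>p\<in>F. c p * f p)" for f
    using insert.hyps by (intro sum.cong) auto
  then have "(\<Sum>p\<in>insert q F. (c(q := a)) p * f p) = a * f q + (\<Sum>p\<in>F. c p * f p)" for f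
    using insert.hyps by simp
  then show ?case using c by (intro exI[of _ "c(q := a)"]) (simp only: diff_diff_eq)
qed

text \<open>
  For bounded sets of Lipschitz functions, convergence on a dense sequence of points implies
  convergence everywhere. A functional that were not small on the functions vanishing at the first \<open>n\<close>
  points, for any \<open>n\<close>, would therefore violate the continuity assumption.
\<close>

lemma in_lip_predual_if_bounded_pointwise_continuous:
  fixes U S :: "'a::metric_space set"
  assumes U: "U \<noteq> {}" and S: "countable S" "S \<subseteq> U" "U \<subseteq> closure S"
    and add: "\<And>f g. f \<in> lip_algebra U \<Longrightarrow> g \<in> lip_algebra U \<Longrightarrow> \<phi> (\<lambda>x. f x + g x) = \<phi> f + \<phi> g"
    and scale: "\<And>f c. f \<in> lip_algebra U \<Longrightarrow> \<phi> (\<lambda>x. c * f x) = c * \<phi> f"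
    and bound: "\<And>f. f \<in> lip_algebra U \<Longrightarrow> \<bar>\<phi> f\<bar> \<le> C * lip_norm U f"
    and cont: "\<And>fs K. (\<And>n. fs n \<in> lip_algebra U) \<Longrightarrow> (\<And>n. lip_norm U (fs n) \<le> K) \<Longrightarrow>
      (\<And>p. p \<in> U \<Longrightarrow> (\<lambda>n. fs n p) \<longlonglongrightarrow> 0) \<Longrightarrow> (\<lambda>n. \<phi> (fs n)) \<longlonglongrightarrow> 0"
  shows "\<phi> \<in> lip_predual U"
proof -
  have "S \<noteq> {}" using U S(3) by auto
  define s where "s = from_nat_into S"
  have s: "s n \<in> U" for n using S(2) \<open>S \<noteq> {}\<close> by (auto simp: s_def from_nat_into subsetD)
  have s_range: "range s = S" using S(1) \<open>S \<noteq> {}\<close> by (simp add: s_def)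
  have "\<exists>F c. finite F \<and> F \<subseteq> U \<and> (\<forall>f\<in>lip_algebra U. \<bar>\<phi> f - (\<Sum>p\<in>F. c p * f p)\<bar> \<le> e * lip_norm U f)"
    if e: "e > 0" for e
  proof -
    have "\<exists>n. \<forall>f\<in>lip_algebra U. (\<forall>k<n. f (s k) = 0) \<longrightarrow> \<bar>\<phi> f\<bar> \<le> e * lip_norm U f"
    proof (rule ccontr)
      assume "\<not> ?thesis"
      then have "\<forall>n. \<exists>f. f \<in> lip_algebra U \<and> (\<forall>k<n. f (s k) = 0) \<and> \<bar>\<phi> f\<bar> > e * lip_norm U f"
        by (auto simp: not_le)
      then obtain f where f: "\<And>n. f n \<in> lip_algebra U" "\<And>n k. k < n \<Longrightarrow> f n (s k) = 0"
          "\<And>n. \<bar>\<phi> (f n)\<bar> > e * lip_norm U (f n)" by metis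
      \<comment> \<open>Normalising by the value of \<open>\<phi>\<close> keeps the norms at most \<open>1 / e\<close> while \<open>\<phi>\<close> has modulus \<open>1\<close> on
        the whole sequence.\<close>
      define a where "a n = 1 / \<bar>\<phi> (f n)\<bar>" for n
      define h where "h n = (\<lambda>p. a n * f n p)" for n
      have pos: "\<bar>\<phi> (f n)\<bar> > 0" for n
        using f(3)[of n] lip_norm_nonneg[OF f(1)[of n] U] e by (smt (verit) mult_nonneg_nonneg)
      have h: "h n \<in> lip_algebra U" for n unfolding h_def by (rule lip_algebra_scale[OF f(1)])
      have hn: "lip_norm U (h n) \<le> 1 / e" for n
      proof -
        have "lip_norm U (h n) \<le> \<bar>a n\<bar> * lip_norm U (f n)"
          unfolding h_def by (rule lip_norm_scale_le[OF f(1) U])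
        also have "\<dots> \<le> 1 / e" using f(3)[of n] pos[of n] e by (simp add: a_def field_simps)
        finally show ?thesis .
      qed
      have "(\<lambda>n. h n p) \<longlonglongrightarrow> 0" if p: "p \<in> U" for p
      proof (rule LIMSEQ_I)
        fix r :: real assume r: "r > 0"
        then have "r * e > 0" using e by simp
        then obtain y where "y \<in> S" "dist y p < r * e"
          using S(3) p by (meson closure_approachable subsetD)
        then obtain k where k: "dist (s k) p < r * e" using s_range by (metis imageE)
        have "norm (h n p - 0) < r" if "n \<ge> Suc k" for n
        proof -
          have "\<bar>h n p - h n (s k)\<bar> \<le> lip_norm U (h n) * dist p (s k)"
            by (rule dist_le_lip_norm[OF h p s])
          also have "\<dots> \<le> 1 / e * dist p (s k)" by (intro mult_right_mono hn) simp
          also have "\<dots> < r" using k e by (simp add: field_simps dist_commute)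
          finally show ?thesis using f(2)[of k n] that by (simp add: h_def)
        qed
        then show "\<exists>no. \<forall>n\<ge>no. norm (h n p - 0) < r" by blast
      qed
      then have "(\<lambda>n. \<phi> (h n)) \<longlonglongrightarrow> 0" by (rule cont[OF h hn])
      then have "(\<lambda>n. \<bar>\<phi> (h n)\<bar>) \<longlonglongrightarrow> 0" by (simp add: tendsto_rabs_zero)
      moreover have "\<bar>\<phi> (h n)\<bar> = 1" for n
        using pos[of n] scale[OF f(1), of "a n" n] by (simp add: h_def a_def abs_mult)
      ultimately show False by (simp add: LIMSEQ_const_iff)
    qed
    then obtain n where n: "\<forall>f\<in>lip_algebra U. (\<forall>k<n. f (s k) = 0) \<longrightarrow> \<bar>\<phi> f\<bar> \<le> e * lip_norm U f"
      by (elim exE)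
    have small: "\<bar>\<phi> f\<bar> \<le> e * lip_norm U f" if "f \<in> lip_algebra U" "\<forall>p\<in>s ` {..<n}. f p = 0" for f
      using n that by simp
    have "\<exists>c. \<forall>f\<in>lip_algebra U. \<bar>\<phi> f - (\<Sum>p\<in>s ` {..<n}. c p * f p)\<bar> \<le> e * lip_norm U f"
    proof (rule approximation_by_evaluations)
      show "\<bar>\<phi> f\<bar> \<le> e * lip_norm U f" if "f \<in> lip_algebra U" "\<forall>p\<in>s ` {..<n}. f p = 0" for f
        using small that .
    qed (use U add scale e in auto)
    moreover have "finite (s ` {..<n})" "s ` {..<n} \<subseteq> U" using s by auto
    ultimately show ?thesis by (intro exI[of _ "s ` {..<n}"]) (simp only: simp_thms)
  qed
  moreover have "\<phi> \<in> lip_dual U"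
    unfolding lip_dual_def mem_Collect_eq using add scale bound by (intro conjI exI[of _ C] ballI allI)
  ultimately show ?thesis by (simp add: lip_predual_def)
qed

lemma zero_in_lip_predual:
  assumes "U \<noteq> {}"
  shows "(\<lambda>_. 0) \<in> lip_predual U"
proof -
  have "(\<lambda>_. 0) \<in> lip_dual U"
    unfolding lip_dual_def mem_Collect_eq by (intro conjI exI[of _ 0]) simp_all
  moreover have "\<exists>F c. finite F \<and> F \<subseteq> U \<and>
      (\<forall>f\<in>lip_algebra U. \<bar>0 - (\<Sum>p\<in>F. c p * f p)\<bar> \<le> e * lip_norm U f)" if "e > 0" for e
    by (rule exI[of _ "{}"]) (use that lip_norm_nonneg[OF _ assms] in simp)
  ultimately show ?thesis by (simp add: lip_predual_def)
qed

lemma lip_predualD: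
  assumes "\<phi> \<in> lip_predual U" "e > 0"
  shows "\<exists>F c. finite F \<and> F \<subseteq> U \<and> (\<forall>f\<in>lip_algebra U. \<bar>\<phi> f - (\<Sum>p\<in>F. c p * f p)\<bar> \<le> e * lip_norm U f)"
  using assms by (simp add: lip_predual_def)

text \<open>
  On bounded sets the functionals of the predual are uniform limits of combinations of evaluations,
  which converge along a pointwise convergent sequence.
\<close>

lemma limitin_lip_weak_star:
  fixes U :: "'a::metric_space set"
  assumes U: "U \<noteq> {}" and fs: "\<And>n. fs n \<in> lip_algebra U" "\<And>n. lip_norm U (fs n) \<le> K"
    and f: "f \<in> lip_algebra U" and lim: "\<And>p. p \<in> U \<Longrightarrow> (\<lambda>n. fs n p) \<longlonglongrightarrow> f p"
  shows "limitin (lip_weak_star U) fs f sequentially"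
proof -
  have conv: "(\<lambda>n. \<phi> (fs n)) \<longlonglongrightarrow> \<phi> f" if \<phi>: "\<phi> \<in> lip_predual U" for \<phi>
  proof (rule LIMSEQ_I)
    fix r :: real assume r: "r > 0"
    define B where "B = \<bar>K\<bar> + lip_norm U f + 1"
    have B: "B > 0" using lip_norm_nonneg[OF f U] by (simp add: B_def)
    define e where "e = r / (2 * B)"
    have e: "e > 0" using r B by (simp add: e_def)
    obtain F c where F: "finite F" "F \<subseteq> U"
        and c: "\<forall>f\<in>lip_algebra U. \<bar>\<phi> f - (\<Sum>p\<in>F. c p * f p)\<bar> \<le> e * lip_norm U f"
      using lip_predualD[OF \<phi> e] by (elim exE conjE)
    have "(\<lambda>n. \<Sum>p\<in>F. c p * fs n p) \<longlonglongrightarrow> (\<Sum>p\<in>F. c p * f p)"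
      using F lim by (intro tendsto_sum tendsto_mult tendsto_const) auto
    then obtain m where m: "\<And>n. n \<ge> m \<Longrightarrow> \<bar>(\<Sum>p\<in>F. c p * fs n p) - (\<Sum>p\<in>F. c p * f p)\<bar> < r / 2"
      using r LIMSEQ_D[of "\<lambda>n. \<Sum>p\<in>F. c p * fs n p" _ "r / 2"] by auto
    have "norm (\<phi> (fs n) - \<phi> f) < r" if "n \<ge> m" for n
    proof -
      have "e * lip_norm U (fs n) + e * lip_norm U f \<le> e * B"
        using fs(2)[of n] e by (simp add: B_def distrib_left[symmetric] mult_left_mono)
      also have "\<dots> = r / 2" using B by (simp add: e_def)
      finally show ?thesis using m[OF that] bspec[OF c fs(1)[of n]] bspec[OF c f]
        unfolding real_norm_def by linarith
    qed
    then show "\<exists>no. \<forall>n\<ge>no. norm (\<phi> (fs n) - \<phi> f) < r" by blast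
  qed
  have "f \<in> W \<longrightarrow> (\<forall>\<^sub>F n in sequentially. fs n \<in> W)"
    if "openin (lip_weak_star U) W" for W
  proof -
    have "generate_topology_on {{f \<in> lip_algebra U. \<phi> f \<in> S} | \<phi> S. \<phi> \<in> lip_predual U \<and> open S} W"
      using that by (simp add: lip_weak_star_def openin_topology_generated_by_iff)
    then show ?thesis
    proof (induction rule: generate_topology_on.induct)
      case (Int a b) then show ?case by (auto intro: eventually_conj)
    next
      case (UN K)
      show ?case
      proof
        assume "f \<in> \<Union>K"
        then obtain k where k: "k \<in> K" "f \<in> k" by blast
        then have "\<forall>\<^sub>F n in sequentially. fs n \<in> k" using UN.IH[OF k(1)] by simp
        then show "\<forall>\<^sub>F n in sequentially. fs n \<in> \<Union>K"
          by (rule eventually_mono) (use k in blast)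
      qed
    next
      case (Basis s)
      then obtain \<phi> S where s: "s = {f \<in> lip_algebra U. \<phi> f \<in> S}" "\<phi> \<in> lip_predual U" "open S" by blast
      show ?case
      proof
        assume "f \<in> s"
        then have "\<phi> f \<in> S" using s by simp
        then have "\<forall>\<^sub>F n in sequentially. \<phi> (fs n) \<in> S"
          using conv[OF s(2)] s(3) topological_tendstoD by blast
        then show "\<forall>\<^sub>F n in sequentially. fs n \<in> s" 
          by (rule eventually_mono) (simp add: s fs)
      qed
    qed simp
  qed
  moreover have "f \<in> topspace (lip_weak_star U)"
  proof -
    have "openin (lip_weak_star U) (lip_algebra U)"
      unfolding lip_weak_star_def
      by (rule topology_generated_by_Basis, rule CollectI, rule exI[of _ "\<lambda>_. 0"], rule exI[of _ UNIV])
        (simp add: zero_in_lip_predual[OF U])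
    then show ?thesis using f openin_subset by blast
  qed
  ultimately show ?thesis by (simp add: limitin_def)
qed

text \<open>
  The functions on which a functional of the predual is nonzero form a weak* open set.
\<close>

lemma predual_functional_vanishes:
  assumes G: "generating_set G" and \<phi>: "\<phi> \<in> lip_predual UNIV"
    and zero: "\<And>f. f \<in> generated_subalgebra G \<Longrightarrow> \<phi> f = 0" and f: "f \<in> lip_algebra UNIV"
  shows "\<phi> f = 0"
proof (rule ccontr)
  assume "\<phi> f \<noteq> 0"
  let ?W = "{f \<in> lip_algebra UNIV. \<phi> f \<in> - {0}}"
  have "openin (lip_weak_star UNIV) ?W"
    unfolding lip_weak_star_def by (rule topology_generated_by_Basis) (use \<phi> in blast)
  moreover have "f \<in> lip_weak_star UNIV closure_of generated_subalgebra G"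
    using G f by (simp add: generating_set_def)
  moreover have "f \<in> ?W" using f \<open>\<phi> f \<noteq> 0\<close> by simp
  ultimately have "\<exists>h. h \<in> generated_subalgebra G \<and> h \<in> ?W" by (simp only: in_closure_of)
  then obtain h where "h \<in> generated_subalgebra G" "h \<in> ?W" by (elim exE conjE)
  then show False using zero by simp
qed

lemma generated_subalgebra_subset:
  assumes "G \<subseteq> lip_algebra UNIV"
  shows "generated_subalgebra G \<subseteq> lip_algebra UNIV"
proof
  fix f assume "f \<in> generated_subalgebra G"
  then show "f \<in> lip_algebra UNIV"
    by induction (use assms in \<open>auto intro: lip_algebra_const lip_algebra_add lip_algebra_mult\<close>)
qed

section \<open>Separability of the space\<close>

text \<open>
  A doubling measure enters the argument through its balls: that they have positive finite measure
  makes the space separable.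
\<close>

definition ball_measure :: "'a::metric_space measure \<Rightarrow> bool" where
  "ball_measure \<mu> \<longleftrightarrow> sets \<mu> = sets borel \<and>
     (\<forall>x r. (0 < r \<longrightarrow> 0 < emeasure \<mu> (ball x r)) \<and> emeasure \<mu> (ball x r) < \<infinity>)"

lemma doubling_imp_ball_measure:
  assumes "doubling_measure \<mu>"
  shows "ball_measure \<mu>"
  unfolding ball_measure_def
proof (intro conjI allI impI)
  show "sets \<mu> = sets borel" using assms by (simp add: doubling_measure_def)
  obtain C :: real where C: "\<And>x r. r > 0 \<Longrightarrow> 0 < emeasure \<mu> (ball x (2 * r)) \<and>
        emeasure \<mu> (ball x (2 * r)) \<le> ennreal C * emeasure \<mu> (ball x r) \<and>
        ennreal C * emeasure \<mu> (ball x r) < \<infinity>"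
    using assms unfolding doubling_measure_def by blast
  show "0 < emeasure \<mu> (ball x r)" if "0 < r" for x r using C[of "r / 2" x] that by simp
  show "emeasure \<mu> (ball x r) < \<infinity>" for x r
  proof (cases "r > 0")
    case True
    then show ?thesis using C[of "r / 2" x] by (auto intro: le_less_trans)
  next
    case False
    then have "ball x r = {}" by simp
    then show ?thesis by (simp only: emeasure_empty) simp
  qed
qed

lemma ball_measureD:
  assumes "ball_measure \<mu>"
  shows ball_measure_sets: "sets \<mu> = sets borel"
    and ball_measure_space: "space \<mu> = UNIV"
    and ball_measure_pos: "0 < r \<Longrightarrow> 0 < emeasure \<mu> (ball x r)"
    and ball_measure_finite: "emeasure \<mu> (ball x r) < \<infinity>"
    and ball_measure_ball_sets: "ball x r \<in> sets \<mu>"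
  using assms sets_eq_imp_space_eq[of \<mu> borel] by (simp_all add: ball_measure_def)

text \<open>
  The balls of radius \<open>r / 2\<close> around the points of \<open>M\<close> are disjoint and have positive measure. Those
  contained in one large ball have finite total measure, so there are countably many of them.
\<close>

lemma countable_separated:
  fixes \<mu> :: "'a::metric_space measure" and M :: "'a set"
  assumes ball: "ball_measure \<mu>"
    and r: "r > 0" and M: "\<And>x y. x \<in> M \<Longrightarrow> y \<in> M \<Longrightarrow> x \<noteq> y \<Longrightarrow> r \<le> dist x y"
  shows "countable M"
proof -
  obtain x0 :: 'a where "True" by simp
  define f where "f s = measure \<mu> (ball s (r / 2))" for s
  have f_pos: "f s > 0" for s
    using ball_measure_pos[OF ball, of "r / 2" s] ball_measure_finite[OF ball, of s "r / 2"] r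
    unfolding f_def measure_def by (simp add: enn2real_positive_iff)
  have "countable {s \<in> M. dist x0 s + r / 2 < real n}" (is "countable ?Mn") for n
  proof -
    have bound: "sum f F \<le> measure \<mu> (ball x0 (real n))" if F: "finite F" "F \<subseteq> ?Mn" for F
    proof -
      have "disjoint_family_on (\<lambda>s. ball s (r / 2)) F"
        unfolding disjoint_family_on_def
      proof (intro ballI impI)
        fix x y assume xy: "x \<in> F" "y \<in> F" "x \<noteq> y"
        then have "r \<le> dist x y" using M F(2) by blast
        then have "ball x (r / 2) \<inter> ball y (r / 2) = {}" by (intro disjoint_ballI) simp
        then show "ball x (r / 2) \<inter> ball y (r / 2) = {}" .
      qed
      then have "sum f F = measure \<mu> (\<Union>s\<in>F. ball s (r / 2))"
        unfolding f_def using F(1) ball_measure_finite[OF ball] ball_measure_ball_sets[OF ball]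
        by (intro measure_finite_Union[symmetric]) (auto simp: less_top)
      also have "\<dots> \<le> measure \<mu> (ball x0 (real n))"
      proof (rule measure_mono_fmeasurable)
        show "(\<Union>s\<in>F. ball s (r / 2)) \<subseteq> ball x0 (real n)"
        proof
          fix y assume "y \<in> (\<Union>s\<in>F. ball s (r / 2))"
          then obtain s where s: "s \<in> F" "dist s y < r / 2" by auto
          then have "dist x0 s + r / 2 < real n" using F(2) by blast
          then show "y \<in> ball x0 (real n)" using s(2) dist_triangle[of x0 y s] by simp
        qed
        show "(\<Union>s\<in>F. ball s (r / 2)) \<in> sets \<mu>" using F(1) ball_measure_ball_sets[OF ball] by (intro sets.finite_UN)
        show "ball x0 (real n) \<in> fmeasurable \<mu>" 
          using ball_measure_finite[OF ball] ball_measure_ball_sets[OF ball] by (intro fmeasurableI)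
      qed
      finally show ?thesis .
    qed
    have "f summable_on ?Mn"
      by (rule nonneg_bdd_above_summable_on)
        (use bound f_pos in \<open>auto simp: less_imp_le bdd_above_def\<close>)
    then have "countable {s \<in> ?Mn. f s \<noteq> 0}"
      by (rule summable_countable_real)
    also have "{s \<in> ?Mn. f s \<noteq> 0} = ?Mn" using f_pos by (auto simp: less_imp_neq[symmetric])
    finally show ?thesis .
  qed
  moreover have "M = (\<Union>n::nat. {s \<in> M. dist x0 s + r / 2 < real n})"
    using reals_Archimedean2 by auto
  ultimately show ?thesis using countable_UN[of UNIV "\<lambda>n. {s \<in> M. dist x0 s + r / 2 < real n}"] by simp
qed

lemma separable_if_ball_measure:
  fixes \<mu> :: "'a::metric_space measure"
  assumes ball: "ball_measure \<mu>"
  shows "\<exists>S::'a set. countable S \<and> closure S = UNIV"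
proof -
  have "\<exists>M::'a set. countable M \<and> (\<forall>x. \<exists>y\<in>M. dist y x < r)" if r: "r > 0" for r
  proof -
    define \<A> where "\<A> = {M::'a set. \<forall>x\<in>M. \<forall>y\<in>M. x \<noteq> y \<longrightarrow> r \<le> dist x y}"
    \<comment> \<open>A maximal \<open>r\<close>-separated set comes within \<open>r\<close> of every point.\<close>
    have "\<exists>M\<in>\<A>. \<forall>X\<in>\<A>. M \<subseteq> X \<longrightarrow> X = M"
    proof (rule subset_Zorn')
      fix C assume C: "subset.chain \<A> C"
      show "\<Union>C \<in> \<A>" unfolding \<A>_def mem_Collect_eq
      proof (intro ballI impI)
        fix x y assume "x \<in> \<Union>C" "y \<in> \<Union>C" and xy: "x \<noteq> y"
        then obtain a b where ab: "a \<in> C" "x \<in> a" "b \<in> C" "y \<in> b" by blast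
        then have "a \<subseteq> b \<or> b \<subseteq> a" using C by (auto simp: subset_chain_def)
        then obtain c where "c \<in> C" "x \<in> c" "y \<in> c" using ab by blast
        moreover have "c \<in> \<A>" using C \<open>c \<in> C\<close> by (auto simp: subset_chain_def)
        ultimately show "r \<le> dist x y" using xy by (auto simp: \<A>_def)
      qed
    qed
    then obtain M where M: "M \<in> \<A>" and max: "\<And>X. X \<in> \<A> \<Longrightarrow> M \<subseteq> X \<Longrightarrow> X = M" by blast
    have near: "\<exists>y\<in>M. dist y x < r" for x
    proof (rule ccontr)
      assume "\<not> ?thesis"
      then have far: "\<And>y. y \<in> M \<Longrightarrow> r \<le> dist y x" by force
      then have "insert x M \<in> \<A>" using M by (auto simp: \<A>_def dist_commute)
      then have "x \<in> M" using max by blast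
      then show False using far[of x] r by simp
    qed
    have "countable M" by (rule countable_separated[OF ball r]) (use M in \<open>simp add: \<A>_def\<close>)
    then show ?thesis using near by (intro exI[of _ M]) simp
  qed
  then have "\<forall>n. \<exists>M::'a set. countable M \<and> (\<forall>x. \<exists>y\<in>M. dist y x < 1 / real (Suc n))" by simp
  then obtain M :: "nat \<Rightarrow> 'a set" where M: "\<And>n. countable (M n)"
      "\<And>n x. \<exists>y\<in>M n. dist y x < 1 / real (Suc n)" by metis
  have "x \<in> closure (\<Union>n. M n)" for x
  proof (unfold closure_approachable, intro allI impI)
    fix e :: real assume "e > 0"
    then obtain n where "1 / real (Suc n) < e" using nat_approx_posE by blast
    then show "\<exists>y\<in>\<Union>n. M n. dist y x < e" using M(2)[of n x] by force
  qed
  then show ?thesis using M(1) by (intro exI[of _ "\<Union>n. M n"]) auto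
qed

section \<open>Essentially bounded coefficients\<close>

text \<open>
  Coefficients on \<open>A\<close> are represented by functions on the whole space. Measurability is asked
  everywhere and boundedness on \<open>A\<close>, so that one representative serves all subsets of \<open>A\<close>.
\<close>

definition ess_bounded :: "'a measure \<Rightarrow> 'a set \<Rightarrow> ('a \<Rightarrow> real) \<Rightarrow> bool" where
  "ess_bounded \<mu> A m \<longleftrightarrow> m \<in> borel_measurable \<mu> \<and> (\<exists>C. AE p in \<mu>. p \<in> A \<longrightarrow> \<bar>m p\<bar> \<le> C)"

lemma ess_boundedD: "ess_bounded \<mu> A m \<Longrightarrow> m \<in> borel_measurable \<mu>"
  by (simp add: ess_bounded_def)

lemma ess_bounded_bound:
  assumes "ess_bounded \<mu> A m"
  obtains C where "C \<ge> 0" "AE p in \<mu>. p \<in> A \<longrightarrow> \<bar>m p\<bar> \<le> C"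
proof -
  obtain C where "AE p in \<mu>. p \<in> A \<longrightarrow> \<bar>m p\<bar> \<le> C" using assms by (auto simp: ess_bounded_def)
  then have "AE p in \<mu>. p \<in> A \<longrightarrow> \<bar>m p\<bar> \<le> max C 0" by eventually_elim auto
  then show thesis by (intro that[of "max C 0"]) auto
qed

lemma ess_bounded_const: "ess_bounded \<mu> A (\<lambda>_. c)"
  by (auto simp: ess_bounded_def)

lemma ess_bounded_add:
  assumes "ess_bounded \<mu> A u" "ess_bounded \<mu> A v"
  shows "ess_bounded \<mu> A (\<lambda>p. u p + v p)"
proof -
  obtain C where C: "AE p in \<mu>. p \<in> A \<longrightarrow> \<bar>u p\<bar> \<le> C" using ess_bounded_bound[OF assms(1)] by metis
  obtain C' where C': "AE p in \<mu>. p \<in> A \<longrightarrow> \<bar>v p\<bar> \<le> C'" using ess_bounded_bound[OF assms(2)] by metis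
  have "AE p in \<mu>. p \<in> A \<longrightarrow> \<bar>u p + v p\<bar> \<le> C + C'" using C C' by eventually_elim auto
  then show ?thesis using assms by (auto simp: ess_bounded_def)
qed

lemma ess_bounded_mult:
  assumes "ess_bounded \<mu> A u" "ess_bounded \<mu> A v"
  shows "ess_bounded \<mu> A (\<lambda>p. u p * v p)"
proof -
  obtain C where C: "C \<ge> 0" "AE p in \<mu>. p \<in> A \<longrightarrow> \<bar>u p\<bar> \<le> C" using ess_bounded_bound[OF assms(1)] .
  obtain C' where C': "AE p in \<mu>. p \<in> A \<longrightarrow> \<bar>v p\<bar> \<le> C'" using ess_bounded_bound[OF assms(2)] .
  have "AE p in \<mu>. p \<in> A \<longrightarrow> \<bar>u p * v p\<bar> \<le> C * C'"
    using C(2) C' by eventually_elim (use C(1) in \<open>auto simp: abs_mult intro: mult_mono\<close>)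
  then show ?thesis using assms by (auto simp: ess_bounded_def)
qed

lemma ess_bounded_subset: "ess_bounded \<mu> A u \<Longrightarrow> B \<subseteq> A \<Longrightarrow> ess_bounded \<mu> B u"
  unfolding ess_bounded_def by (fast elim: eventually_mono)

lemma integrable_ess_bounded_mult:
  fixes h :: "'a \<Rightarrow> real"
  assumes "ess_bounded \<mu> A m" "integrable \<mu> h" "\<And>p. p \<notin> A \<Longrightarrow> h p = 0"
  shows "integrable \<mu> (\<lambda>p. m p * h p)"
proof -
  obtain C where C: "AE p in \<mu>. p \<in> A \<longrightarrow> \<bar>m p\<bar> \<le> C" using ess_bounded_bound[OF assms(1)] .
  show ?thesis
  proof (rule Bochner_Integration.integrable_bound)
    show "integrable \<mu> (\<lambda>p. C * h p)" using assms(2) by simp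
    show "(\<lambda>p. m p * h p) \<in> borel_measurable \<mu>" using ess_boundedD[OF assms(1)] assms(2) by measurable
    show "AE p in \<mu>. norm (m p * h p) \<le> norm (C * h p)"
      using C
    proof eventually_elim
      case (elim p)
      then show ?case using assms(3)[of p] by (cases "p \<in> A") (auto simp: abs_mult intro: mult_right_mono)
    qed
  qed
qed

lemma Linf_iff:
  assumes A: "A \<in> sets \<mu>"
  shows "f \<in> Linf (restrict_space \<mu> A) \<longleftrightarrow> ess_bounded \<mu> A (\<lambda>p. indicator A p * f p)"
proof -
  let ?R = "restrict_space \<mu> A"
  have meas: "f \<in> borel_measurable ?R \<longleftrightarrow> (\<lambda>p. indicator A p * f p) \<in> borel_measurable \<mu>"
    using A borel_measurable_restrict_space_iff[of A \<mu> f] by (simp add: sets.Int_space_eq2 mult.commute)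
  have AE: "(AE p in ?R. \<bar>f p\<bar> \<le> C) \<longleftrightarrow> (AE p in \<mu>. p \<in> A \<longrightarrow> \<bar>indicator A p * f p\<bar> \<le> C)" for C
    using A by (subst AE_restrict_space_iff) (auto simp: sets.Int_space_eq2 intro!: arg_cong[of _ _ "\<lambda>P. almost_everywhere \<mu> P"])
  have "Linf_norm ?R f < \<infinity> \<longleftrightarrow> (\<exists>C. AE p in ?R. \<bar>f p\<bar> \<le> C)" if "f \<in> borel_measurable ?R"
  proof
    assume "Linf_norm ?R f < \<infinity>"
    then obtain n :: nat where n: "Linf_norm ?R f < ereal (real n)" by (auto simp: less_PInf_Ex_of_nat)
    have "AE p in ?R. ereal \<bar>f p\<bar> \<le> Linf_norm ?R f" unfolding Linf_norm_def by (rule esssup_AE)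
    then have "AE p in ?R. \<bar>f p\<bar> \<le> real n"
    proof eventually_elim
      case (elim p)
      then have "ereal \<bar>f p\<bar> \<le> ereal (real n)" using n by order
      then show ?case by simp
    qed
    then show "\<exists>C. AE p in ?R. \<bar>f p\<bar> \<le> C" by blast
  next
    assume "\<exists>C. AE p in ?R. \<bar>f p\<bar> \<le> C"
    then obtain C where "AE p in ?R. \<bar>f p\<bar> \<le> C" by blast
    then have "Linf_norm ?R f \<le> ereal C"
      unfolding Linf_norm_def using that by (intro esssup_I) auto
    then show "Linf_norm ?R f < \<infinity>" by (auto intro: le_less_trans)
  qed
  then show ?thesis unfolding Linf_def ess_bounded_def mem_Collect_eq meas[symmetric] AE[symmetric] by blast
qed

section \<open>Functions with vanishing pointwise Lipschitz constant\<close>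

text \<open>
  The values of \<open>f\<close> near \<open>p\<close> differ from \<open>f p\<close> by \<open>o(dist p y)\<close>. In this form the vanishing of the
  pointwise Lipschitz constant is visibly a linear and local condition.
\<close>

definition flat_at :: "('a::metric_space \<Rightarrow> real) \<Rightarrow> 'a \<Rightarrow> bool" where
  "flat_at f p \<longleftrightarrow> (\<forall>e>0. \<exists>r>0. \<forall>y\<in>ball p r. \<bar>f p - f y\<bar> \<le> e * dist p y)"

lemma pointwise_Lip_eq_0_iff: "pointwise_Lip f p = 0 \<longleftrightarrow> flat_at f p"
proof
  assume L: "pointwise_Lip f p = 0"
  show "flat_at f p" unfolding flat_at_def
  proof (intro allI impI)
    fix e :: real assume e: "e > 0"
    have "pointwise_Lip f p < ennreal (e / 2)" using L e by simp
    then obtain r where r: "r > 0"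
      and S: "(SUP s\<in>{0<..r}. ennreal (1 / s) * (SUP y\<in>ball p s. ennreal \<bar>f p - f y\<bar>)) < ennreal (e / 2)"
      unfolding pointwise_Lip_def by (auto simp: INF_less_iff)
    have "\<bar>f p - f y\<bar> \<le> e * dist p y" if y: "y \<in> ball p r" for y
    proof (cases "y = p")
      case False
      \<comment> \<open>A radius slightly larger than \<open>dist p y\<close> is needed, since balls are open; the factor \<open>2\<close>
        is absorbed by using \<open>e / 2\<close>.\<close>
      define s where "s = min r (2 * dist p y)"
      have s: "s > 0" "s \<le> r" "dist p y < s" "s \<le> 2 * dist p y"
        using y r False by (auto simp: s_def)
      have "ennreal (1 / s) * ennreal \<bar>f p - f y\<bar> \<le> ennreal (1 / s) * (SUP y\<in>ball p s. ennreal \<bar>f p - f y\<bar>)"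
        using s by (intro mult_left_mono SUP_upper) auto
      also have "\<dots> \<le> (SUP s\<in>{0<..r}. ennreal (1 / s) * (SUP y\<in>ball p s. ennreal \<bar>f p - f y\<bar>))"
        using s by (intro SUP_upper) auto
      also have "\<dots> \<le> ennreal (e / 2)" using S by simp
      finally have "ennreal (\<bar>f p - f y\<bar> / s) \<le> ennreal (e / 2)"
        using s by (simp add: ennreal_mult[symmetric])
      then have "\<bar>f p - f y\<bar> \<le> e / 2 * s" using e s by (simp add: pos_divide_le_eq)
      also have "\<dots> \<le> e / 2 * (2 * dist p y)" using s e by (intro mult_left_mono) auto
      finally show ?thesis by simp
    qed simp
    then show "\<exists>r>0. \<forall>y\<in>ball p r. \<bar>f p - f y\<bar> \<le> e * dist p y" using r by blast
  qed
next
  assume L: "flat_at f p"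
  have "pointwise_Lip f p \<le> 0"
  proof (rule ennreal_le_epsilon)
    fix e :: real assume e: "e > 0"
    then obtain r where r: "r > 0" "\<And>y. y \<in> ball p r \<Longrightarrow> \<bar>f p - f y\<bar> \<le> e * dist p y"
      using L unfolding flat_at_def by blast
    have "ennreal (1 / s) * (SUP y\<in>ball p s. ennreal \<bar>f p - f y\<bar>) \<le> ennreal e" if s: "s \<in> {0<..r}" for s
    proof -
      have "(SUP y\<in>ball p s. ennreal \<bar>f p - f y\<bar>) \<le> ennreal (e * s)"
      proof (rule SUP_least)
        fix y assume y: "y \<in> ball p s"
        have "\<bar>f p - f y\<bar> \<le> e * dist p y" using r(2)[of y] y s by auto
        also have "\<dots> \<le> e * s" using y e by (intro mult_left_mono) auto
        finally show "ennreal \<bar>f p - f y\<bar> \<le> ennreal (e * s)" by (rule ennreal_leI)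
      qed
      then have "ennreal (1 / s) * (SUP y\<in>ball p s. ennreal \<bar>f p - f y\<bar>) \<le> ennreal (1 / s) * ennreal (e * s)"
        by (rule mult_left_mono) simp
      also have "\<dots> = ennreal e" using s e by (simp add: ennreal_mult[symmetric])
      finally show ?thesis .
    qed
    then show "pointwise_Lip f p \<le> 0 + ennreal e"
      unfolding pointwise_Lip_def using r(1) by (intro INF_lower2[of r] SUP_least) auto
  qed
  then show "pointwise_Lip f p = 0" by simp
qed

lemma flat_at_zero: "flat_at (\<lambda>_. 0) p"
  unfolding flat_at_def using zero_less_one by force

lemma flat_at_add:
  assumes "flat_at f p" "flat_at g p"
  shows "flat_at (\<lambda>y. f y + g y) p"
  unfolding flat_at_def
proof (intro allI impI)
  fix e :: real assume "e > 0"
  then have e: "e / 2 > 0" by simp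
  obtain r where r: "r > 0" "\<And>y. y \<in> ball p r \<Longrightarrow> \<bar>f p - f y\<bar> \<le> e / 2 * dist p y"
    using assms(1) e unfolding flat_at_def by blast
  obtain s where s: "s > 0" "\<And>y. y \<in> ball p s \<Longrightarrow> \<bar>g p - g y\<bar> \<le> e / 2 * dist p y"
    using assms(2) e unfolding flat_at_def by blast
  have "\<bar>f p + g p - (f y + g y)\<bar> \<le> e * dist p y" if "y \<in> ball p (min r s)" for y
  proof -
    have "\<bar>f p - f y\<bar> \<le> e / 2 * dist p y" "\<bar>g p - g y\<bar> \<le> e / 2 * dist p y" using r(2) s(2) that by auto
    moreover have "e / 2 * dist p y + e / 2 * dist p y = e * dist p y" by (simp add: field_simps)
    ultimately show ?thesis by linarith
  qed
  then show "\<exists>r>0. \<forall>y\<in>ball p r. \<bar>f p + g p - (f y + g y)\<bar> \<le> e * dist p y"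
    using r(1) s(1) by (intro exI[of _ "min r s"]) auto
qed

lemma flat_at_scale:
  assumes "flat_at f p"
  shows "flat_at (\<lambda>y. c * f y) p"
proof (cases "c = 0")
  case True then show ?thesis by (simp add: flat_at_zero)
next
  case False
  show ?thesis unfolding flat_at_def
  proof (intro allI impI)
    fix e :: real assume "e > 0"
    then have e: "e / \<bar>c\<bar> > 0" using False by simp
    obtain r where r: "r > 0" "\<And>y. y \<in> ball p r \<Longrightarrow> \<bar>f p - f y\<bar> \<le> e / \<bar>c\<bar> * dist p y"
      using assms e unfolding flat_at_def by blast
    have "\<bar>c * f p - c * f y\<bar> \<le> e * dist p y" if "y \<in> ball p r" for y
    proof -
      have "\<bar>c * f p - c * f y\<bar> = \<bar>c\<bar> * \<bar>f p - f y\<bar>" by (simp add: abs_mult[symmetric] algebra_simps)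
      also have "\<dots> \<le> \<bar>c\<bar> * (e / \<bar>c\<bar> * dist p y)" using r(2)[OF that] by (rule mult_left_mono) simp
      finally show ?thesis using False by simp
    qed
    then show "\<exists>r>0. \<forall>y\<in>ball p r. \<bar>c * f p - c * f y\<bar> \<le> e * dist p y" using r(1) by blast
  qed
qed

lemma flat_at_cong_near:
  assumes "flat_at f p" "r > 0" "\<And>y. y \<in> ball p r \<Longrightarrow> g y = f y"
  shows "flat_at g p"
  unfolding flat_at_def
proof (intro allI impI)
  fix e :: real assume "e > 0"
  then obtain s where s: "s > 0" "\<And>y. y \<in> ball p s \<Longrightarrow> \<bar>f p - f y\<bar> \<le> e * dist p y"
    using assms(1) unfolding flat_at_def by blast
  then show "\<exists>r>0. \<forall>y\<in>ball p r. \<bar>g p - g y\<bar> \<le> e * dist p y"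
    using assms(2,3) by (intro exI[of _ "min r s"]) auto
qed

section \<open>Derivations localised to a set\<close>

text \<open>
  A derivation on \<open>A\<close> that acts on bounded Lipschitz functions of the whole space. The last clause
  is weak* continuity along bounded sequences, tested on null sequences (enough by linearity) and
  against weights that vanish outside \<open>A\<close>. With such weights, passing to a subset of \<open>A\<close> only shrinks
  the class of weights, and a bounded coefficient can be moved from the derivation to the weight.
\<close>

definition local_derivation :: "'a::metric_space measure \<Rightarrow> 'a set \<Rightarrow> (('a \<Rightarrow> real) \<Rightarrow> 'a \<Rightarrow> real) \<Rightarrow> bool" where
  "local_derivation \<mu> A E \<longleftrightarrow>
     (\<forall>f\<in>lip_algebra UNIV. E f \<in> borel_measurable \<mu>) \<and>
     (\<exists>C\<ge>0. \<forall>f\<in>lip_algebra UNIV. AE p in \<mu>. p \<in> A \<longrightarrow> \<bar>E f p\<bar> \<le> C * lip_norm UNIV f) \<and>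
     (\<forall>f\<in>lip_algebra UNIV. \<forall>g\<in>lip_algebra UNIV.
        AE p in \<mu>. p \<in> A \<longrightarrow> E (\<lambda>x. f x + g x) p = E f p + E g p) \<and>
     (\<forall>f\<in>lip_algebra UNIV. \<forall>c. AE p in \<mu>. p \<in> A \<longrightarrow> E (\<lambda>x. c * f x) p = c * E f p) \<and>
     (\<forall>f\<in>lip_algebra UNIV. \<forall>g\<in>lip_algebra UNIV.
        AE p in \<mu>. p \<in> A \<longrightarrow> E (\<lambda>x. f x * g x) p = E f p * g p + f p * E g p) \<and>
     (\<forall>fs K h. (\<forall>n. fs n \<in> lip_algebra UNIV \<and> lip_norm UNIV (fs n) \<le> K) \<and> (\<forall>p. (\<lambda>n. fs n p) \<longlonglongrightarrow> 0) \<and>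
        integrable \<mu> h \<and> (\<forall>p. p \<notin> A \<longrightarrow> h p = 0) \<longrightarrow> (\<lambda>n. \<integral>p. E (fs n) p * h p \<partial>\<mu>) \<longlonglongrightarrow> 0)"

lemma local_derivationD:
  assumes "local_derivation \<mu> A E"
  shows local_derivation_measurable: "f \<in> lip_algebra UNIV \<Longrightarrow> E f \<in> borel_measurable \<mu>"
    and local_derivation_bound:
      "\<exists>C\<ge>0. \<forall>f\<in>lip_algebra UNIV. AE p in \<mu>. p \<in> A \<longrightarrow> \<bar>E f p\<bar> \<le> C * lip_norm UNIV f"
    and local_derivation_add: "f \<in> lip_algebra UNIV \<Longrightarrow> g \<in> lip_algebra UNIV \<Longrightarrow>
      AE p in \<mu>. p \<in> A \<longrightarrow> E (\<lambda>x. f x + g x) p = E f p + E g p"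
    and local_derivation_scale: "f \<in> lip_algebra UNIV \<Longrightarrow>
      AE p in \<mu>. p \<in> A \<longrightarrow> E (\<lambda>x. c * f x) p = c * E f p"
    and local_derivation_mult: "f \<in> lip_algebra UNIV \<Longrightarrow> g \<in> lip_algebra UNIV \<Longrightarrow>
      AE p in \<mu>. p \<in> A \<longrightarrow> E (\<lambda>x. f x * g x) p = E f p * g p + f p * E g p"
  using assms unfolding local_derivation_def by simp_all

lemma local_derivation_continuous:
  assumes "local_derivation \<mu> A E" "\<And>n. fs n \<in> lip_algebra UNIV"
    "\<And>n. lip_norm UNIV (fs n) \<le> K" "\<And>p. (\<lambda>n. fs n p) \<longlonglongrightarrow> 0"
    "integrable \<mu> h" "\<And>p. p \<notin> A \<Longrightarrow> h p = 0"
  shows "(\<lambda>n. \<integral>p. E (fs n) p * h p \<partial>\<mu>) \<longlonglongrightarrow> 0"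
proof -
  have "\<forall>fs K h. (\<forall>n. fs n \<in> lip_algebra UNIV \<and> lip_norm UNIV (fs n) \<le> K) \<and> (\<forall>p. (\<lambda>n. fs n p) \<longlonglongrightarrow> 0) \<and>
        integrable \<mu> h \<and> (\<forall>p. p \<notin> A \<longrightarrow> h p = 0) \<longrightarrow> (\<lambda>n. \<integral>p. E (fs n) p * h p \<partial>\<mu>) \<longlonglongrightarrow> 0"
    using assms(1) unfolding local_derivation_def by (elim conjE)
  from this[rule_format, of fs K h] show ?thesis using assms by simp
qed

lemma local_derivation_ess_bounded:
  assumes "local_derivation \<mu> A E" "f \<in> lip_algebra UNIV"
  shows "ess_bounded \<mu> A (E f)"
  using local_derivation_bound[OF assms(1)] local_derivation_measurable[OF assms] assms(2)
  unfolding ess_bounded_def by blast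

lemma local_derivation_subset:
  assumes E: "local_derivation \<mu> A E" and "B \<subseteq> A"
  shows "local_derivation \<mu> B E"
proof -
  have sub: "AE p in \<mu>. p \<in> B \<longrightarrow> P p" if "AE p in \<mu>. p \<in> A \<longrightarrow> P p" for P
    using that by (rule eventually_mono) (use \<open>B \<subseteq> A\<close> in auto)
  obtain C where C: "C \<ge> 0" "\<And>f. f \<in> lip_algebra UNIV \<Longrightarrow> AE p in \<mu>. p \<in> A \<longrightarrow> \<bar>E f p\<bar> \<le> C * lip_norm UNIV f"
    using local_derivation_bound[OF E] by blast
  have "(\<lambda>n. \<integral>p. E (fs n) p * h p \<partial>\<mu>) \<longlonglongrightarrow> 0"
    if "\<forall>n. fs n \<in> lip_algebra UNIV \<and> lip_norm UNIV (fs n) \<le> K" "\<forall>p. (\<lambda>n. fs n p) \<longlonglongrightarrow> 0"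
       "integrable \<mu> h" "\<forall>p. p \<notin> B \<longrightarrow> h p = 0" for fs K h
    by (rule local_derivation_continuous[OF E, of fs K h]) (use that \<open>B \<subseteq> A\<close> in auto)
  then show ?thesis
    unfolding local_derivation_def
    by (intro conjI ballI allI impI exI[of _ C] sub C local_derivation_measurable[OF E]
        local_derivation_add[OF E] local_derivation_scale[OF E] local_derivation_mult[OF E]) auto
qed

text \<open>
  The coefficients are absorbed into the weights: \<open>\<integral> (a E f + b D f) h = \<integral> E f (a h) + \<integral> D f (b h)\<close>.
\<close>

lemma local_derivation_combination:
  assumes E: "local_derivation \<mu> A E" and D: "local_derivation \<mu> A D"
    and a: "ess_bounded \<mu> A a" and b: "ess_bounded \<mu> A b"
  shows "local_derivation \<mu> A (\<lambda>f p. a p * E f p + b p * D f p)"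
  unfolding local_derivation_def
proof (intro conjI ballI allI impI)
  fix f :: "'a \<Rightarrow> real" assume f: "f \<in> lip_algebra UNIV"
  show "(\<lambda>p. a p * E f p + b p * D f p) \<in> borel_measurable \<mu>"
    using local_derivation_measurable[OF E f] local_derivation_measurable[OF D f]
      ess_boundedD[OF a] ess_boundedD[OF b] by measurable
  show "AE p in \<mu>. p \<in> A \<longrightarrow> a p * E (\<lambda>x. c * f x) p + b p * D (\<lambda>x. c * f x) p =
      c * (a p * E f p + b p * D f p)" for c
    using local_derivation_scale[OF E f, of c] local_derivation_scale[OF D f, of c]
    by eventually_elim (simp add: algebra_simps)
  fix g :: "'a \<Rightarrow> real" assume g: "g \<in> lip_algebra UNIV"
  show "AE p in \<mu>. p \<in> A \<longrightarrow> a p * E (\<lambda>x. f x + g x) p + b p * D (\<lambda>x. f x + g x) p =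
      a p * E f p + b p * D f p + (a p * E g p + b p * D g p)"
    using local_derivation_add[OF E f g] local_derivation_add[OF D f g]
    by eventually_elim (simp add: algebra_simps)
  show "AE p in \<mu>. p \<in> A \<longrightarrow> a p * E (\<lambda>x. f x * g x) p + b p * D (\<lambda>x. f x * g x) p =
      (a p * E f p + b p * D f p) * g p + f p * (a p * E g p + b p * D g p)"
    using local_derivation_mult[OF E f g] local_derivation_mult[OF D f g]
    by eventually_elim (simp add: algebra_simps)
next
  obtain C where C: "C \<ge> 0" "\<And>f. f \<in> lip_algebra UNIV \<Longrightarrow> AE p in \<mu>. p \<in> A \<longrightarrow> \<bar>E f p\<bar> \<le> C * lip_norm UNIV f"
    using local_derivation_bound[OF E] by blast
  obtain C' where C': "C' \<ge> 0" "\<And>f. f \<in> lip_algebra UNIV \<Longrightarrow> AE p in \<mu>. p \<in> A \<longrightarrow> \<bar>D f p\<bar> \<le> C' * lip_norm UNIV f"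
    using local_derivation_bound[OF D] by blast
  obtain K where K: "K \<ge> 0" "AE p in \<mu>. p \<in> A \<longrightarrow> \<bar>a p\<bar> \<le> K" using ess_bounded_bound[OF a] .
  obtain K' where K': "K' \<ge> 0" "AE p in \<mu>. p \<in> A \<longrightarrow> \<bar>b p\<bar> \<le> K'" using ess_bounded_bound[OF b] .
  have "AE p in \<mu>. p \<in> A \<longrightarrow> \<bar>a p * E f p + b p * D f p\<bar> \<le> (K * C + K' * C') * lip_norm UNIV f"
    if f: "f \<in> lip_algebra UNIV" for f
    using C(2)[OF f] C'(2)[OF f] K(2) K'(2)
  proof eventually_elim
    case (elim p)
    show ?case
    proof
      assume "p \<in> A"
      then have "\<bar>a p\<bar> * \<bar>E f p\<bar> \<le> K * (C * lip_norm UNIV f)" "\<bar>b p\<bar> * \<bar>D f p\<bar> \<le> K' * (C' * lip_norm UNIV f)"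
        using elim K(1) K'(1) by (auto intro: mult_mono)
      moreover have "\<bar>a p * E f p + b p * D f p\<bar> \<le> \<bar>a p\<bar> * \<bar>E f p\<bar> + \<bar>b p\<bar> * \<bar>D f p\<bar>"
        by (metis abs_mult abs_triangle_ineq)
      ultimately show "\<bar>a p * E f p + b p * D f p\<bar> \<le> (K * C + K' * C') * lip_norm UNIV f"
        by (simp add: distrib_right mult.assoc)
    qed
  qed
  then show "\<exists>C\<ge>0. \<forall>f\<in>lip_algebra UNIV. AE p in \<mu>. p \<in> A \<longrightarrow>
      \<bar>a p * E f p + b p * D f p\<bar> \<le> C * lip_norm UNIV f"
    using C(1) C'(1) K(1) K'(1) by (intro exI[of _ "K * C + K' * C'"]) auto
next
  fix fs :: "nat \<Rightarrow> 'a \<Rightarrow> real" and K and h :: "'a \<Rightarrow> real"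
  assume H: "(\<forall>n. fs n \<in> lip_algebra UNIV \<and> lip_norm UNIV (fs n) \<le> K) \<and> (\<forall>p. (\<lambda>n. fs n p) \<longlonglongrightarrow> 0) \<and>
    integrable \<mu> h \<and> (\<forall>p. p \<notin> A \<longrightarrow> h p = 0)"
  then have h: "integrable \<mu> h" "\<And>p. p \<notin> A \<Longrightarrow> h p = 0" and fs: "\<And>n. fs n \<in> lip_algebra UNIV" by auto
  have ah: "integrable \<mu> (\<lambda>p. a p * h p)" and bh: "integrable \<mu> (\<lambda>p. b p * h p)"
    using integrable_ess_bounded_mult a b h by blast+
  have "(\<lambda>n. \<integral>p. E (fs n) p * (a p * h p) \<partial>\<mu>) \<longlonglongrightarrow> 0"
    by (rule local_derivation_continuous[OF E, of fs K]) (use H ah in auto)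
  moreover have "(\<lambda>n. \<integral>p. D (fs n) p * (b p * h p) \<partial>\<mu>) \<longlonglongrightarrow> 0"
    by (rule local_derivation_continuous[OF D, of fs K]) (use H bh in auto)
  ultimately have "(\<lambda>n. (\<integral>p. E (fs n) p * (a p * h p) \<partial>\<mu>) + (\<integral>p. D (fs n) p * (b p * h p) \<partial>\<mu>)) \<longlonglongrightarrow> 0 + 0"
    by (rule tendsto_add)
  moreover have "(\<integral>p. (a p * E (fs n) p + b p * D (fs n) p) * h p \<partial>\<mu>) =
      (\<integral>p. E (fs n) p * (a p * h p) \<partial>\<mu>) + (\<integral>p. D (fs n) p * (b p * h p) \<partial>\<mu>)" for n
  proof -
    have "integrable \<mu> (\<lambda>p. E (fs n) p * (a p * h p))"
      by (rule integrable_ess_bounded_mult[OF local_derivation_ess_bounded[OF E fs] ah]) (simp add: h)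
    moreover have "integrable \<mu> (\<lambda>p. D (fs n) p * (b p * h p))"
      by (rule integrable_ess_bounded_mult[OF local_derivation_ess_bounded[OF D fs] bh]) (simp add: h)
    ultimately show ?thesis
      by (subst Bochner_Integration.integral_add[symmetric]) (auto simp: algebra_simps)
  qed
  ultimately show "(\<lambda>n. \<integral>p. (a p * E (fs n) p + b p * D (fs n) p) * h p \<partial>\<mu>) \<longlonglongrightarrow> 0" by simp
qed

lemma local_derivation_functional_in_predual:
  assumes ball: "ball_measure \<mu>"
    and E: "local_derivation \<mu> A E"
    and h: "integrable \<mu> h" "\<And>p. p \<notin> A \<Longrightarrow> h p = 0"
  shows "(\<lambda>f. \<integral>p. E f p * h p \<partial>\<mu>) \<in> lip_predual UNIV"
proof -
  obtain S :: "'a set" where S: "countable S" "closure S = UNIV" 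
    using separable_if_ball_measure[OF ball] by blast
  obtain C where C: "C \<ge> 0" "\<And>f. f \<in> lip_algebra UNIV \<Longrightarrow> AE p in \<mu>. p \<in> A \<longrightarrow> \<bar>E f p\<bar> \<le> C * lip_norm UNIV f"
    using local_derivation_bound[OF E] by blast
  have int: "integrable \<mu> (\<lambda>p. E f p * h p)" if "f \<in> lip_algebra UNIV" for f
    using integrable_ess_bounded_mult[OF local_derivation_ess_bounded[OF E that]] h by blast
  show ?thesis
  proof (rule in_lip_predual_if_bounded_pointwise_continuous)
    fix f g :: "'a \<Rightarrow> real" assume f: "f \<in> lip_algebra UNIV" and g: "g \<in> lip_algebra UNIV"
    have "(\<integral>p. E (\<lambda>x. f x + g x) p * h p \<partial>\<mu>) = (\<integral>p. E f p * h p + E g p * h p \<partial>\<mu>)"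
    proof (rule integral_cong_AE)
      show "AE p in \<mu>. E (\<lambda>x. f x + g x) p * h p = E f p * h p + E g p * h p"
        using local_derivation_add[OF E f g] by (rule eventually_mono) (use h in \<open>auto simp: algebra_simps\<close>)
    qed (use int f g lip_algebra_add[OF f g] in \<open>auto intro!: borel_measurable_integrable Bochner_Integration.integrable_add\<close>)
    then show "(\<integral>p. E (\<lambda>x. f x + g x) p * h p \<partial>\<mu>) = (\<integral>p. E f p * h p \<partial>\<mu>) + (\<integral>p. E g p * h p \<partial>\<mu>)"
      using int f g by simp
  next
    fix f :: "'a \<Rightarrow> real" and c assume f: "f \<in> lip_algebra UNIV"
    have "(\<integral>p. E (\<lambda>x. c * f x) p * h p \<partial>\<mu>) = (\<integral>p. c * (E f p * h p) \<partial>\<mu>)"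
    proof (rule integral_cong_AE)
      show "AE p in \<mu>. E (\<lambda>x. c * f x) p * h p = c * (E f p * h p)"
        using local_derivation_scale[OF E f, of c] by (rule eventually_mono) (use h in \<open>auto simp: algebra_simps\<close>)
    qed (use int f lip_algebra_scale[OF f] in \<open>auto intro!: borel_measurable_integrable Bochner_Integration.integrable_mult_right\<close>)
    then show "(\<integral>p. E (\<lambda>x. c * f x) p * h p \<partial>\<mu>) = c * (\<integral>p. E f p * h p \<partial>\<mu>)" by simp
  next
    fix f :: "'a \<Rightarrow> real" assume f: "f \<in> lip_algebra UNIV"
    have "\<bar>\<integral>p. E f p * h p \<partial>\<mu>\<bar> \<le> (\<integral>p. \<bar>E f p * h p\<bar> \<partial>\<mu>)" by (rule integral_abs_bound)
    also have "\<dots> \<le> (\<integral>p. (C * lip_norm UNIV f) * \<bar>h p\<bar> \<partial>\<mu>)"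
    proof (rule integral_mono_AE)
      show "AE p in \<mu>. \<bar>E f p * h p\<bar> \<le> (C * lip_norm UNIV f) * \<bar>h p\<bar>"
        using C(2)[OF f]
      proof eventually_elim
        case (elim p)
        then show ?case using h(2)[of p] by (cases "p \<in> A") (auto simp: abs_mult intro: mult_right_mono)
      qed
    qed (use int[OF f] h(1) in auto)
    finally show "\<bar>\<integral>p. E f p * h p \<partial>\<mu>\<bar> \<le> (C * (\<integral>p. \<bar>h p\<bar> \<partial>\<mu>)) * lip_norm UNIV f"
      by (simp add: algebra_simps)
  next
    fix fs :: "nat \<Rightarrow> 'a \<Rightarrow> real" and K
    assume "\<And>n. fs n \<in> lip_algebra UNIV" "\<And>n. lip_norm UNIV (fs n) \<le> K"
      "\<And>p. p \<in> UNIV \<Longrightarrow> (\<lambda>n. fs n p) \<longlonglongrightarrow> 0"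
    then show "(\<lambda>n. \<integral>p. E (fs n) p * h p \<partial>\<mu>) \<longlonglongrightarrow> 0"
      by (intro local_derivation_continuous[OF E _ _ _ h]) auto
  qed (use S in auto)
qed

lemma local_derivation_zero_on_subalgebra:
  assumes E: "local_derivation \<mu> A E" and G: "G \<subseteq> lip_algebra UNIV"
    and zero: "\<And>g. g \<in> G \<Longrightarrow> AE p in \<mu>. p \<in> A \<longrightarrow> E g p = 0"
    and f: "f \<in> generated_subalgebra G"
  shows "AE p in \<mu>. p \<in> A \<longrightarrow> E f p = 0"
proof -
  have sub: "h \<in> lip_algebra UNIV" if "h \<in> generated_subalgebra G" for h
    using that generated_subalgebra_subset[OF G] by blast
  show ?thesis using f
  proof induction
    case (const c)
    \<comment> \<open>The Leibniz rule for \<open>1 = 1 * 1\<close> gives \<open>E 1 = 2 E 1\<close>.\<close>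
    have "AE p in \<mu>. p \<in> A \<longrightarrow> E (\<lambda>_. 1 * 1) p = E (\<lambda>_. 1) p * 1 + 1 * E (\<lambda>_. 1) p"
      by (rule local_derivation_mult[OF E lip_algebra_const lip_algebra_const])
    moreover have "AE p in \<mu>. p \<in> A \<longrightarrow> E (\<lambda>_. c * 1) p = c * E (\<lambda>_. 1) p"
      by (rule local_derivation_scale[OF E lip_algebra_const])
    ultimately show ?case by eventually_elim simp
  next
    case (gen g) then show ?case by (rule zero)
  next
    case (add f h)
    show ?case
      using add.IH local_derivation_add[OF E sub[OF add.hyps(1)] sub[OF add.hyps(2)]]
      by eventually_elim simp
  next
    case (mult f h)
    show ?case
      using mult.IH local_derivation_mult[OF E sub[OF mult.hyps(1)] sub[OF mult.hyps(2)]]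
      by eventually_elim simp
  qed
qed

text \<open>
  The functional obtained by integrating against \<open>sgn (E f)\<close> on a bounded part of \<open>A\<close> lies in the
  predual and kills the generated subalgebra, hence also \<open>f\<close>; its value at \<open>f\<close> is the integral of
  \<open>\<bar>E f\<bar>\<close>.
\<close>

lemma local_derivation_zero_if_zero_on_generators:
  assumes ball: "ball_measure \<mu>"
    and E: "local_derivation \<mu> A E" and A: "A \<in> sets \<mu>" and G: "generating_set G"
    and zero: "\<And>g. g \<in> G \<Longrightarrow> AE p in \<mu>. p \<in> A \<longrightarrow> E g p = 0"
    and f: "f \<in> lip_algebra UNIV"
  shows "AE p in \<mu>. p \<in> A \<longrightarrow> E f p = 0"
proof -
  obtain x0 :: 'a where "True" by simp
  have GL: "G \<subseteq> lip_algebra UNIV" using G by (simp add: generating_set_def)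
  note [measurable] = local_derivation_measurable[OF E f] A ball_measure_ball_sets[OF ball]
  \<comment> \<open>Intersecting with balls makes the weight integrable.\<close>
  have "AE p in \<mu>. p \<in> A \<inter> ball x0 (real n) \<longrightarrow> E f p = 0" for n
  proof -
    define B where "B = A \<inter> ball x0 (real n)"
    have B [measurable]: "B \<in> sets \<mu>" by (simp add: B_def)
    have "emeasure \<mu> B \<le> emeasure \<mu> (ball x0 (real n))" unfolding B_def by (intro emeasure_mono) auto
    then have Bfin: "emeasure \<mu> B < \<infinity>" using ball_measure_finite[OF ball] le_less_trans by blast
    define h where "h p = indicator B p * sgn (E f p)" for p
    have h: "integrable \<mu> h"
    proof (rule Bochner_Integration.integrable_bound)
      show "integrable \<mu> (indicator B :: 'a \<Rightarrow> real)" using Bfin by simp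
      show "h \<in> borel_measurable \<mu>" unfolding h_def by measurable
      show "AE p in \<mu>. norm (h p) \<le> norm (indicator B p :: real)"
        by (auto simp: h_def indicator_def sgn_real_def)
    qed
    have h0: "h p = 0" if "p \<notin> A" for p using that by (simp add: h_def B_def)
    have "(\<integral>p. E f p * h p \<partial>\<mu>) = 0"
    proof (rule predual_functional_vanishes[OF G local_derivation_functional_in_predual[OF ball E h h0] _ f])
      fix u assume u: "u \<in> generated_subalgebra G"
      have "AE p in \<mu>. E u p * h p = 0"
        using local_derivation_zero_on_subalgebra[OF E GL zero u] by (rule eventually_mono) (use h0 in auto)
      then show "(\<integral>p. E u p * h p \<partial>\<mu>) = 0" by (rule integral_eq_zero_AE)
    qed
    moreover have "E f p * h p = indicator B p * \<bar>E f p\<bar>" for p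
      by (simp add: h_def sgn_real_def)
    moreover have "integrable \<mu> (\<lambda>p. E f p * h p)"
      using integrable_ess_bounded_mult[OF local_derivation_ess_bounded[OF E f] h h0] .
    ultimately have "AE p in \<mu>. indicator B p * \<bar>E f p\<bar> = 0"
      by (subst (asm) integral_nonneg_eq_0_iff_AE) auto
    then show ?thesis by (rule eventually_mono) (auto simp: B_def indicator_def split: if_splits)
  qed
  then have "AE p in \<mu>. \<forall>n. p \<in> A \<inter> ball x0 (real n) \<longrightarrow> E f p = 0" unfolding AE_all_countable ..
  then show ?thesis
    by (rule eventually_mono) (use reals_Archimedean2 in \<open>auto simp: mem_ball\<close>)
qed

section \<open>Charts with derivations\<close>

definition lipschitz_function :: "('a::metric_space \<Rightarrow> real) \<Rightarrow> bool" where
  "lipschitz_function f \<longleftrightarrow> (\<exists>L. L-lipschitz_on UNIV f)"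

text \<open>
  A chart whose partial derivatives are derivations. By linearity, uniqueness of partial derivatives
  amounts to the statement that only almost everywhere vanishing coefficients give a flat
  combination of the coordinates; the existence clause covers unbounded Lipschitz functions, on
  which the \<open>E j\<close> do not act.
\<close>

definition derivation_chart ::
  "'a::metric_space measure \<Rightarrow> 'a set \<Rightarrow> nat \<Rightarrow> (nat \<Rightarrow> 'a \<Rightarrow> real) \<Rightarrow> (nat \<Rightarrow> ('a \<Rightarrow> real) \<Rightarrow> 'a \<Rightarrow> real) \<Rightarrow> bool" where
  "derivation_chart \<mu> A n x E \<longleftrightarrow>
     A \<in> sets \<mu> \<and>
     (\<forall>j<n. lipschitz_function (x j)) \<and>
     (\<forall>f. lipschitz_function f \<longrightarrow> (\<exists>d. (\<forall>j<n. ess_bounded \<mu> A (d j)) \<and>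
        (AE p in \<mu>. p \<in> A \<longrightarrow> flat_at (\<lambda>y. f y - (\<Sum>j<n. d j p * x j y)) p))) \<and>
     (\<forall>d. (\<forall>j<n. ess_bounded \<mu> A (d j)) \<and>
        (AE p in \<mu>. p \<in> A \<longrightarrow> flat_at (\<lambda>y. \<Sum>j<n. d j p * x j y) p) \<longrightarrow>
        (\<forall>j<n. AE p in \<mu>. p \<in> A \<longrightarrow> d j p = 0)) \<and>
     (\<forall>j<n. local_derivation \<mu> A (E j)) \<and>
     (\<forall>f\<in>lip_algebra UNIV. AE p in \<mu>. p \<in> A \<longrightarrow> flat_at (\<lambda>y. f y - (\<Sum>j<n. E j f p * x j y)) p)"

lemma derivation_chartD:
  assumes "derivation_chart \<mu> A n x E"
  shows derivation_chart_sets: "A \<in> sets \<mu>"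
    and derivation_chart_lipschitz: "j < n \<Longrightarrow> lipschitz_function (x j)"
    and derivation_chart_exists: "lipschitz_function f \<Longrightarrow> \<exists>d. (\<forall>j<n. ess_bounded \<mu> A (d j)) \<and>
        (AE p in \<mu>. p \<in> A \<longrightarrow> flat_at (\<lambda>y. f y - (\<Sum>j<n. d j p * x j y)) p)"
    and derivation_chart_derivation: "j < n \<Longrightarrow> local_derivation \<mu> A (E j)"
    and derivation_chart_partials: "g \<in> lip_algebra UNIV \<Longrightarrow>
        AE p in \<mu>. p \<in> A \<longrightarrow> flat_at (\<lambda>y. g y - (\<Sum>j<n. E j g p * x j y)) p"
  using assms unfolding derivation_chart_def by simp_all

lemma derivation_chart_unique:
  assumes "derivation_chart \<mu> A n x E" "\<And>j. j < n \<Longrightarrow> ess_bounded \<mu> A (d j)"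
    "AE p in \<mu>. p \<in> A \<longrightarrow> flat_at (\<lambda>y. \<Sum>j<n. d j p * x j y) p" "j < n"
  shows "AE p in \<mu>. p \<in> A \<longrightarrow> d j p = 0"
proof -
  have "\<forall>d. (\<forall>j<n. ess_bounded \<mu> A (d j)) \<and>
        (AE p in \<mu>. p \<in> A \<longrightarrow> flat_at (\<lambda>y. \<Sum>j<n. d j p * x j y) p) \<longrightarrow>
        (\<forall>j<n. AE p in \<mu>. p \<in> A \<longrightarrow> d j p = 0)"
    using assms(1) unfolding derivation_chart_def by (elim conjE)
  from this[rule_format, of d j] show ?thesis using assms by simp
qed

lemma derivation_chart_subset:
  assumes chart: "derivation_chart \<mu> A n x E" and B: "B \<subseteq> A" "B \<in> sets \<mu>"
  shows "derivation_chart \<mu> B n x E"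
proof -
  have sub: "AE p in \<mu>. p \<in> B \<longrightarrow> P p" if "AE p in \<mu>. p \<in> A \<longrightarrow> P p" for P
    using that by (rule eventually_mono) (use B in auto)
  have "AE p in \<mu>. p \<in> B \<longrightarrow> d j p = 0"
    if d: "(\<forall>j<n. ess_bounded \<mu> B (d j)) \<and> (AE p in \<mu>. p \<in> B \<longrightarrow> flat_at (\<lambda>y. \<Sum>j<n. d j p * x j y) p)"
      and j: "j < n" for d j
  proof -
    \<comment> \<open>Extended by zero, coefficients on \<open>B\<close> are coefficients on \<open>A\<close>.\<close>
    define c where "c j p = (indicator B p :: real) * d j p" for j p
    have "AE p in \<mu>. p \<in> A \<longrightarrow> c j p = 0"
    proof (rule derivation_chart_unique[OF chart _ _ j])
      fix i assume i: "i < n"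
      obtain C where C: "C \<ge> 0" "AE p in \<mu>. p \<in> B \<longrightarrow> \<bar>d i p\<bar> \<le> C"
        using ess_bounded_bound[of \<mu> B "d i"] d i by blast
      have "AE p in \<mu>. p \<in> A \<longrightarrow> \<bar>c i p\<bar> \<le> C"
        using C(2) by (rule eventually_mono) (use C(1) in \<open>auto simp: c_def indicator_def\<close>)
      moreover have "d i \<in> borel_measurable \<mu>" using d i ess_boundedD by blast
      then have "c i \<in> borel_measurable \<mu>" using B(2) unfolding c_def by measurable
      ultimately show "ess_bounded \<mu> A (c i)" by (auto simp: ess_bounded_def)
    next
      have "AE p in \<mu>. p \<in> B \<longrightarrow> flat_at (\<lambda>y. \<Sum>j<n. d j p * x j y) p" using d by simp
      then show "AE p in \<mu>. p \<in> A \<longrightarrow> flat_at (\<lambda>y. \<Sum>j<n. c j p * x j y) p"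
        by (rule eventually_mono) (auto simp: c_def indicator_def flat_at_zero)
    qed
    then show ?thesis by (rule eventually_mono) (use B in \<open>auto simp: c_def\<close>)
  qed
  moreover have "\<exists>d. (\<forall>j<n. ess_bounded \<mu> B (d j)) \<and>
        (AE p in \<mu>. p \<in> B \<longrightarrow> flat_at (\<lambda>y. f y - (\<Sum>j<n. d j p * x j y)) p)"
    if "lipschitz_function f" for f
    using derivation_chart_exists[OF chart that] sub ess_bounded_subset[OF _ B(1)] by meson
  ultimately show ?thesis
    using B(2) derivation_chart_lipschitz[OF chart] sub[OF derivation_chart_partials[OF chart]]
      local_derivation_subset[OF derivation_chart_derivation[OF chart] B(1)]
    unfolding derivation_chart_def by simp
qed

lemma lipschitz_function_bounded: "f \<in> lip_algebra UNIV \<Longrightarrow> lipschitz_function f"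
  by (auto simp: lip_algebra_def lipschitz_function_def)

text \<open>
  Coordinates may be unbounded, whereas the derivations act on bounded functions only.
\<close>

definition truncation :: "real \<Rightarrow> ('a::metric_space \<Rightarrow> real) \<Rightarrow> 'a \<Rightarrow> real" where
  "truncation m f p = max (- m) (min m (f p))"

lemma truncation_in_lip_algebra:
  assumes "lipschitz_function f"
  shows "truncation m f \<in> lip_algebra UNIV"
proof -
  obtain L where L: "L-lipschitz_on UNIV f" using assms by (auto simp: lipschitz_function_def)
  show ?thesis
  proof (rule lip_algebraI)
    show "L-lipschitz_on UNIV (truncation m f)"
    proof (rule lipschitz_onI)
      fix p q
      have "\<bar>truncation m f p - truncation m f q\<bar> \<le> \<bar>f p - f q\<bar>"
        by (simp add: truncation_def)
      also have "\<dots> \<le> L * dist p q" using lipschitz_onD[OF L, of p q] by (simp add: dist_real_def)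
      finally show "dist (truncation m f p) (truncation m f q) \<le> L * dist p q" by (simp add: dist_real_def)
    qed (rule lipschitz_on_nonneg[OF L])
    show "\<bar>truncation m f p\<bar> \<le> \<bar>m\<bar>" for p by (simp add: truncation_def)
  qed simp
qed

lemma lipschitz_function_measurable:
  assumes ball: "ball_measure \<mu>"
    and "lipschitz_function f"
  shows "f \<in> borel_measurable \<mu>"
proof -
  have "continuous_on UNIV f" using assms(2) by (auto simp: lipschitz_function_def dest: lipschitz_on_continuous_on)
  then have "f \<in> borel_measurable borel" by (rule borel_measurable_continuous_onI)
  then show ?thesis using ball_measure_sets[OF ball] by (simp cong: measurable_cong_sets)
qed

text \<open>
  Where \<open>\<bar>x k\<bar> < m\<close>, the truncation coincides with \<open>x k\<close> near the point, so its partial derivatives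
  there are those of \<open>x k\<close>.
\<close>

lemma partial_of_truncated_coordinate:
  assumes ball: "ball_measure \<mu>"
    and chart: "derivation_chart \<mu> A n x E" and k: "k < n"
  shows "AE p in \<mu>. p \<in> A \<longrightarrow> \<bar>x k p\<bar> < m \<longrightarrow> E k (truncation m (x k)) p = 1"
proof -
  let ?F = "truncation m (x k)"
  have xk: "lipschitz_function (x k)" using derivation_chart_lipschitz[OF chart k] .
  have F: "?F \<in> lip_algebra UNIV" using truncation_in_lip_algebra[OF xk] .
  have cont: "continuous_on UNIV (x k)" using xk by (auto simp: lipschitz_function_def dest: lipschitz_on_continuous_on)
  \<comment> \<open>The partial derivatives of \<open>x k\<close> minus those of its truncation, set to zero where the two
    functions are not compared.\<close>
  define c where "c j p = (if \<bar>x k p\<bar> < m then (if j = k then 1 else 0) - E j ?F p else 0)" for j p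
  have "AE p in \<mu>. p \<in> A \<longrightarrow> c k p = 0"
  proof (rule derivation_chart_unique[OF chart _ _ k])
    fix j assume j: "j < n"
    have b: "ess_bounded \<mu> A (E j ?F)"
      using local_derivation_ess_bounded[OF derivation_chart_derivation[OF chart j] F] .
    then obtain C where C: "C \<ge> 0" "AE p in \<mu>. p \<in> A \<longrightarrow> \<bar>E j ?F p\<bar> \<le> C" using ess_bounded_bound by blast
    have "AE p in \<mu>. p \<in> A \<longrightarrow> \<bar>c j p\<bar> \<le> 1 + C"
      using C(2) by (rule eventually_mono) (use C(1) in \<open>auto simp: c_def abs_le_iff\<close>)
    moreover have "c j \<in> borel_measurable \<mu>"
      using lipschitz_function_measurable[OF ball xk] ess_boundedD[OF b] unfolding c_def by measurable
    ultimately show "ess_bounded \<mu> A (c j)" by (auto simp: ess_bounded_def)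
  next
    show "AE p in \<mu>. p \<in> A \<longrightarrow> flat_at (\<lambda>y. \<Sum>j<n. c j p * x j y) p"
      using derivation_chart_partials[OF chart F]
    proof (rule eventually_mono, intro impI)
      fix p assume P: "p \<in> A \<longrightarrow> flat_at (\<lambda>y. ?F y - (\<Sum>j<n. E j ?F p * x j y)) p" and p: "p \<in> A"
      show "flat_at (\<lambda>y. \<Sum>j<n. c j p * x j y) p"
      proof (cases "\<bar>x k p\<bar> < m")
        case True
        have "open {y. \<bar>x k y\<bar> < m}"
          using cont by (intro open_Collect_less continuous_intros) auto
        then obtain r where r: "r > 0" "ball p r \<subseteq> {y. \<bar>x k y\<bar> < m}"
          using True openE by (metis mem_Collect_eq)
        have delta: "(\<Sum>j<n. (if j = k then 1 else 0) * x j y) = x k y" for y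
        proof -
          have "(\<Sum>j<n. (if j = k then 1 else 0) * x j y) = (\<Sum>j<n. if j = k then x j y else 0)"
            by (intro sum.cong) auto
          also have "\<dots> = x k y" using k by (simp add: sum.delta)
          finally show ?thesis .
        qed
        show ?thesis
        proof (rule flat_at_cong_near[OF P[rule_format, OF p] r(1)])
          fix y assume "y \<in> ball p r"
          then have "\<bar>x k y\<bar> < m" using r(2) by blast
          then have "?F y = x k y" by (auto simp: truncation_def)
          moreover have "(\<Sum>j<n. c j p * x j y) = (\<Sum>j<n. (if j = k then 1 else 0) * x j y) - (\<Sum>j<n. E j ?F p * x j y)"
            using True by (simp add: c_def sum_subtractf[symmetric] left_diff_distrib)
          ultimately show "(\<Sum>j<n. c j p * x j y) = ?F y - (\<Sum>j<n. E j ?F p * x j y)" using delta by simp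
        qed
      next
        case False
        then show ?thesis by (simp add: c_def flat_at_zero)
      qed
    qed
  qed
  then show ?thesis by (rule eventually_mono) (auto simp: c_def)
qed

lemma some_generator_has_nonzero_partial:
  assumes ball: "ball_measure \<mu>"
    and chart: "derivation_chart \<mu> A n x E" and k: "k < n"
    and G: "generating_set G" "countable G"
  shows "AE p in \<mu>. p \<in> A \<longrightarrow> (\<exists>g\<in>G. E k g p \<noteq> 0)"
proof -
  note E = derivation_chart_derivation[OF chart k]
  define B where "B = {p \<in> A. \<forall>g\<in>G. E k g p = 0}"
  have GL: "g \<in> lip_algebra UNIV" if "g \<in> G" for g using G that by (auto simp: generating_set_def)
  have [measurable]: "E k g \<in> borel_measurable \<mu>" if "g \<in> G" for g
    using local_derivation_measurable[OF E GL[OF that]] .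
  note [measurable] = derivation_chart_sets[OF chart]
  have "{p \<in> space \<mu>. p \<in> A \<and> (\<forall>g\<in>G. E k g p = 0)} \<in> sets \<mu>"
    using G(2) by measurable
  then have B: "B \<in> sets \<mu>" by (simp add: B_def ball_measure_space[OF ball])
  have E': "local_derivation \<mu> B (E k)" by (rule local_derivation_subset[OF E]) (auto simp: B_def)
  have zero: "AE p in \<mu>. p \<in> B \<longrightarrow> E k (truncation (real m) (x k)) p = 0" for m
    by (rule local_derivation_zero_if_zero_on_generators[OF ball E' B G(1)])
      (auto simp: B_def intro: truncation_in_lip_algebra derivation_chart_lipschitz[OF chart k])
  have "AE p in \<mu>. p \<in> B \<longrightarrow> \<not> \<bar>x k p\<bar> < real m" for m
    using zero[of m] partial_of_truncated_coordinate[OF ball chart k, of "real m"]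
    by eventually_elim (auto simp: B_def)
  then have "AE p in \<mu>. \<forall>m. p \<in> B \<longrightarrow> \<not> \<bar>x k p\<bar> < real m" unfolding AE_all_countable ..
  then show ?thesis
  proof (rule eventually_mono)
    fix p assume "\<forall>m. p \<in> B \<longrightarrow> \<not> \<bar>x k p\<bar> < real m"
    then have "p \<notin> B" using reals_Archimedean2 by blast
    then show "p \<in> A \<longrightarrow> (\<exists>g\<in>G. E k g p \<noteq> 0)" by (auto simp: B_def)
  qed
qed

section \<open>Exchanging a coordinate\<close>

text \<open>
  The coordinates \<open>w\<close> arise from \<open>\<xi>\<close> by replacing the \<open>k\<close>-th one by \<open>\<gamma>\<close>. If \<open>\<gamma>\<close> equals
  \<open>\<Sum>j<n. e j * \<xi> j\<close> up to a flat error, then coefficients \<open>v\<close> with respect to \<open>w\<close> and \<open>u\<close> with respect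
  to \<open>\<xi>\<close> describe the same function up to a flat error.
\<close>

lemma sum_exchange:
  fixes u v e \<xi> :: "nat \<Rightarrow> real"
  assumes k: "k < n" and w: "w k = \<gamma>" "\<And>j. j \<noteq> k \<Longrightarrow> w j = \<xi> j"
    and v: "v k * e k = u k" "\<And>j. j \<noteq> k \<Longrightarrow> v j = u j - v k * e j"
  shows "(\<Sum>j<n. v j * w j) = (\<Sum>j<n. u j * \<xi> j) + v k * (\<gamma> - (\<Sum>j<n. e j * \<xi> j))"
proof -
  have split: "(\<Sum>j<n. h j) = h k + (\<Sum>j\<in>{..<n} - {k}. h j)" for h :: "nat \<Rightarrow> real"
    using k by (intro sum.remove) auto
  have "(\<Sum>j\<in>{..<n} - {k}. v j * w j) = (\<Sum>j\<in>{..<n} - {k}. u j * \<xi> j - v k * (e j * \<xi> j))"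
    by (intro sum.cong) (auto simp: v(2) w(2) algebra_simps)
  also have "\<dots> = (\<Sum>j\<in>{..<n} - {k}. u j * \<xi> j) - v k * (\<Sum>j\<in>{..<n} - {k}. e j * \<xi> j)"
    by (simp add: sum_subtractf sum_distrib_left)
  finally show ?thesis
    unfolding split[of "\<lambda>j. v j * w j"] split[of "\<lambda>j. u j * \<xi> j"] split[of "\<lambda>j. e j * \<xi> j"]
    using w(1) v(1) by (simp add: algebra_simps)
qed

text \<open>
  To first order \<open>g\<close> is \<open>\<Sum>j<n. E j g * x j\<close>, which can be solved for \<open>x k\<close> where \<open>E k g\<close> does not
  vanish. The lower bound \<open>c\<close> keeps the new coefficients bounded.
\<close>

lemma derivation_chart_exchange:
  assumes chart: "derivation_chart \<mu> A n x E" and k: "k < n"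
    and g: "g \<in> lip_algebra UNIV" and c: "c > 0" "\<And>p. p \<in> A \<Longrightarrow> c \<le> \<bar>E k g p\<bar>"
  shows "\<exists>E'. derivation_chart \<mu> A n (x(k := g)) E'"
proof -
  note der = derivation_chart_derivation[OF chart]
  have Eg: "ess_bounded \<mu> A (E j g)" if "j < n" for j
    using local_derivation_ess_bounded[OF der[OF that] g] .
  have nz: "E k g p \<noteq> 0" if "p \<in> A" for p using c that by force
  define a :: "nat \<Rightarrow> real" where "a j = (if j = k then 0 else 1)" for j
  define b where "b j p = (if j = k then 1 else - E j g p) * (1 / E k g p)" for j p
  have a: "ess_bounded \<mu> A (\<lambda>_. a j)" for j by (rule ess_bounded_const)
  have inv: "ess_bounded \<mu> A (\<lambda>p. 1 / E k g p)"
  proof -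
    have "\<bar>1 / E k g p\<bar> \<le> 1 / c" if "p \<in> A" for p
      using c(1) c(2)[OF that] by (simp add: frac_le)
    then show ?thesis using ess_boundedD[OF Eg[OF k]] unfolding ess_bounded_def by (auto intro!: exI[of _ "1 / c"])
  qed
  have b: "ess_bounded \<mu> A (b j)" if "j < n" for j
  proof (cases "j = k")
    case True
    then have "b j = (\<lambda>p. 1 / E k g p)" by (intro ext) (simp add: b_def)
    then show ?thesis using inv by simp
  next
    case False
    then have "b j = (\<lambda>p. - 1 * E j g p * (1 / E k g p))" by (intro ext) (simp add: b_def)
    then show ?thesis
      using ess_bounded_mult[OF ess_bounded_mult[OF ess_bounded_const Eg[OF that]] inv] by (simp only:)
  qed
  \<comment> \<open>Coefficients \<open>u\<close> with respect to \<open>x\<close> become \<open>\<lambda>j. a j * u j + b j p * u k\<close>.\<close>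
  have key: "(\<Sum>j<n. (a j * u j + b j p * u k) * (x(k := g)) j y) =
      (\<Sum>j<n. u j * x j y) + u k / E k g p * (g y - (\<Sum>j<n. E j g p * x j y))" if "p \<in> A" for p y u
  proof -
    have "(\<Sum>j<n. (a j * u j + b j p * u k) * (x(k := g)) j y) =
      (\<Sum>j<n. u j * x j y) + (a k * u k + b k p * u k) * (g y - (\<Sum>j<n. E j g p * x j y))"
      by (rule sum_exchange[OF k]) (use nz[OF that] in \<open>auto simp: a_def b_def field_simps\<close>)
    then show ?thesis by (simp add: a_def b_def)
  qed
  have flat: "AE p in \<mu>. p \<in> A \<longrightarrow>
      flat_at (\<lambda>y. f y - (\<Sum>j<n. (a j * u j p + b j p * u k p) * (x(k := g)) j y)) p"
    if f: "AE p in \<mu>. p \<in> A \<longrightarrow> flat_at (\<lambda>y. f y - (\<Sum>j<n. u j p * x j y)) p" for f u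
    using f derivation_chart_partials[OF chart g]
  proof (rule eventually_elim2, intro impI)
    fix p assume p: "p \<in> A" and "p \<in> A \<longrightarrow> flat_at (\<lambda>y. f y - (\<Sum>j<n. u j p * x j y)) p"
      "p \<in> A \<longrightarrow> flat_at (\<lambda>y. g y - (\<Sum>j<n. E j g p * x j y)) p"
    then have "flat_at (\<lambda>y. (f y - (\<Sum>j<n. u j p * x j y)) +
        (- (u k p / E k g p)) * (g y - (\<Sum>j<n. E j g p * x j y))) p"
      by (intro flat_at_add flat_at_scale) auto
    then show "flat_at (\<lambda>y. f y - (\<Sum>j<n. (a j * u j p + b j p * u k p) * (x(k := g)) j y)) p"
      unfolding key[OF p, of "\<lambda>j. u j p"] by (simp add: algebra_simps)
  qed
  have "derivation_chart \<mu> A n (x(k := g)) (\<lambda>j f p. a j * E j f p + b j p * E k f p)"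
    unfolding derivation_chart_def
  proof (intro conjI allI impI ballI)
    show "A \<in> sets \<mu>" by (rule derivation_chart_sets[OF chart])
    show "lipschitz_function ((x(k := g)) j)" if "j < n" for j
      using derivation_chart_lipschitz[OF chart that] lipschitz_function_bounded[OF g] by simp
    show "local_derivation \<mu> A (\<lambda>f p. a j * E j f p + b j p * E k f p)" if "j < n" for j
      by (rule local_derivation_combination[OF der[OF that] der[OF k] a b[OF that]])
    show "AE p in \<mu>. p \<in> A \<longrightarrow>
        flat_at (\<lambda>y. f y - (\<Sum>j<n. (a j * E j f p + b j p * E k f p) * (x(k := g)) j y)) p"
      if "f \<in> lip_algebra UNIV" for f
      by (rule flat[OF derivation_chart_partials[OF chart that]])
    show "\<exists>d. (\<forall>j<n. ess_bounded \<mu> A (d j)) \<and>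
        (AE p in \<mu>. p \<in> A \<longrightarrow> flat_at (\<lambda>y. f y - (\<Sum>j<n. d j p * (x(k := g)) j y)) p)"
      if f: "lipschitz_function f" for f
    proof -
      obtain d where d: "\<And>j. j < n \<Longrightarrow> ess_bounded \<mu> A (d j)"
          "AE p in \<mu>. p \<in> A \<longrightarrow> flat_at (\<lambda>y. f y - (\<Sum>j<n. d j p * x j y)) p"
        using derivation_chart_exists[OF chart f] by blast
      have "AE p in \<mu>. p \<in> A \<longrightarrow>
          flat_at (\<lambda>y. f y - (\<Sum>j<n. (a j * d j p + b j p * d k p) * (x(k := g)) j y)) p"
        by (rule flat[OF d(2)])
      moreover have "ess_bounded \<mu> A (\<lambda>p. a j * d j p + b j p * d k p)" if "j < n" for j
        using a b d(1) k that by (intro ess_bounded_add ess_bounded_mult) auto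
      ultimately show ?thesis by (intro exI[of _ "\<lambda>j p. a j * d j p + b j p * d k p"]) simp
    qed
    fix d j
    assume d: "(\<forall>j<n. ess_bounded \<mu> A (d j)) \<and>
      (AE p in \<mu>. p \<in> A \<longrightarrow> flat_at (\<lambda>y. \<Sum>j<n. d j p * (x(k := g)) j y) p)" and j: "j < n"
    \<comment> \<open>The coefficients of the same combination with respect to \<open>x\<close>, up to a flat error.\<close>
    define e where "e i p = a i * d i p + d k p * E i g p" for i p
    have e: "AE p in \<mu>. p \<in> A \<longrightarrow> e i p = 0" if i: "i < n" for i
    proof (rule derivation_chart_unique[OF chart _ _ i])
      show "ess_bounded \<mu> A (e i)" if "i < n" for i
        unfolding e_def using a d k that Eg by (intro ess_bounded_add ess_bounded_mult) auto
      have "AE p in \<mu>. p \<in> A \<longrightarrow> flat_at (\<lambda>y. \<Sum>j<n. d j p * (x(k := g)) j y) p" using d by simp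
      then show "AE p in \<mu>. p \<in> A \<longrightarrow> flat_at (\<lambda>y. \<Sum>i<n. e i p * x i y) p"
        using derivation_chart_partials[OF chart g]
      proof (rule eventually_elim2, intro impI)
        fix p assume p: "p \<in> A" and "p \<in> A \<longrightarrow> flat_at (\<lambda>y. \<Sum>j<n. d j p * (x(k := g)) j y) p"
          "p \<in> A \<longrightarrow> flat_at (\<lambda>y. g y - (\<Sum>j<n. E j g p * x j y)) p"
        then have "flat_at (\<lambda>y. (\<Sum>j<n. d j p * (x(k := g)) j y) + (- d k p) * (g y - (\<Sum>j<n. E j g p * x j y))) p"
          by (intro flat_at_add flat_at_scale) auto
        moreover have "(\<Sum>j<n. d j p * (x(k := g)) j y) = (\<Sum>i<n. e i p * x i y) + d k p * (g y - (\<Sum>j<n. E j g p * x j y))" for y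
          by (rule sum_exchange[OF k]) (auto simp: e_def a_def)
        ultimately show "flat_at (\<lambda>y. \<Sum>i<n. e i p * x i y) p" by (simp add: algebra_simps)
      qed
    qed
    show "AE p in \<mu>. p \<in> A \<longrightarrow> d j p = 0"
      using e[OF k] e[OF j]
    proof (rule eventually_elim2, intro impI)
      fix p assume p: "p \<in> A" and "p \<in> A \<longrightarrow> e k p = 0" "p \<in> A \<longrightarrow> e j p = 0"
      then have "d k p = 0" using nz[OF p] by (simp add: e_def a_def)
      then show "d j p = 0" using \<open>p \<in> A \<longrightarrow> e j p = 0\<close> p by (cases "j = k") (simp_all add: e_def a_def)
    qed
  qed
  then show ?thesis by blast
qed

section \<open>Covering by charts with coordinates among the generators\<close>

definition has_chart_in :: "'a::metric_space measure \<Rightarrow> ('a \<Rightarrow> real) set \<Rightarrow> nat \<Rightarrow> 'a set \<Rightarrow> bool" where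
  "has_chart_in \<mu> G n A \<longleftrightarrow> (\<exists>x E. derivation_chart \<mu> A n x E \<and> (\<forall>j<n. x j \<in> G))"

text \<open>
  The sets need not be disjoint: charts pass to measurable subsets, so that a countable cover can be
  made disjoint in the end.
\<close>

definition covered_by_charts_in :: "'a::metric_space measure \<Rightarrow> ('a \<Rightarrow> real) set \<Rightarrow> nat \<Rightarrow> 'a set \<Rightarrow> bool" where
  "covered_by_charts_in \<mu> G n A \<longleftrightarrow>
     (\<exists>\<C>. countable \<C> \<and> (\<forall>C\<in>\<C>. has_chart_in \<mu> G n C) \<and> (AE p in \<mu>. p \<in> A \<longrightarrow> p \<in> \<Union>\<C>))"

lemma covered_by_charts_in_Union:
  assumes \<D>: "countable \<D>" "\<And>D. D \<in> \<D> \<Longrightarrow> covered_by_charts_in \<mu> G n D"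
    and A: "AE p in \<mu>. p \<in> A \<longrightarrow> p \<in> \<Union>\<D>"
  shows "covered_by_charts_in \<mu> G n A"
proof -
  have "\<forall>D\<in>\<D>. \<exists>\<C>. countable \<C> \<and> (\<forall>C\<in>\<C>. has_chart_in \<mu> G n C) \<and> (AE p in \<mu>. p \<in> D \<longrightarrow> p \<in> \<Union>\<C>)"
    using \<D>(2) by (simp add: covered_by_charts_in_def)
  then obtain \<C> where "\<forall>D\<in>\<D>. countable (\<C> D) \<and> (\<forall>C\<in>\<C> D. has_chart_in \<mu> G n C) \<and>
      (AE p in \<mu>. p \<in> D \<longrightarrow> p \<in> \<Union>(\<C> D))"
    by (rule bchoice[THEN exE])
  then have \<C>: "\<And>D. D \<in> \<D> \<Longrightarrow> countable (\<C> D)"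
      "\<And>D C. D \<in> \<D> \<Longrightarrow> C \<in> \<C> D \<Longrightarrow> has_chart_in \<mu> G n C"
      "\<And>D. D \<in> \<D> \<Longrightarrow> AE p in \<mu>. p \<in> D \<longrightarrow> p \<in> \<Union>(\<C> D)"
    by simp_all
  have "AE p in \<mu>. \<forall>D\<in>\<D>. p \<in> D \<longrightarrow> p \<in> \<Union>(\<C> D)"
    using \<C>(3) \<D>(1) by (rule AE_ball_countable')
  then have "AE p in \<mu>. p \<in> A \<longrightarrow> p \<in> \<Union>(\<Union>D\<in>\<D>. \<C> D)"
    using A by eventually_elim blast
  moreover have "countable (\<Union>D\<in>\<D>. \<C> D)" using \<D>(1) \<C>(1) by (rule countable_UN)
  ultimately show ?thesis
    unfolding covered_by_charts_in_def using \<C>(2) by (intro exI[of _ "\<Union>D\<in>\<D>. \<C> D"]) auto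
qed

text \<open>
  Induction on the number \<open>l\<close> of coordinates that may still lie outside \<open>G\<close>; the coordinate with
  index \<open>l - 1\<close> is exchanged next.
\<close>

lemma chart_covered_by_charts_in_generators:
  assumes ball: "ball_measure \<mu>"
    and G: "generating_set G" "countable G"
    and "derivation_chart \<mu> A n x E" "\<And>j. j < n \<Longrightarrow> l \<le> j \<Longrightarrow> x j \<in> G"
  shows "covered_by_charts_in \<mu> G n A"
  using assms(4,5)
proof (induction l arbitrary: A x E)
  case 0
  then have "has_chart_in \<mu> G n A" by (auto simp: has_chart_in_def)
  then show ?case unfolding covered_by_charts_in_def by (intro exI[of _ "{A}"]) auto
next
  case (Suc l)
  show ?case
  proof (cases "l < n")
    case False
    then show ?thesis using Suc.IH[OF Suc.prems(1)] by simp
  next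
    case True
    note chart = Suc.prems(1)
    have GL: "g \<in> lip_algebra UNIV" if "g \<in> G" for g using G that by (auto simp: generating_set_def)
    define P where "P gi = {p \<in> A. 1 / real (Suc (snd gi)) \<le> \<bar>E l (fst gi) p\<bar>}" for gi :: "('a \<Rightarrow> real) \<times> nat"
    show ?thesis
    proof (rule covered_by_charts_in_Union[of "P ` (G \<times> UNIV)"])
      show "countable (P ` (G \<times> UNIV))" using G(2) by simp
    next
      fix D assume "D \<in> P ` (G \<times> UNIV)"
      then obtain g i where g: "g \<in> G" and D: "D = P (g, i)" by auto
      note [measurable] = local_derivation_measurable[OF derivation_chart_derivation[OF chart True] GL[OF g]]
        derivation_chart_sets[OF chart]
      have "{p \<in> space \<mu>. p \<in> A \<and> 1 / real (Suc i) \<le> \<bar>E l g p\<bar>} \<in> sets \<mu>" by measurable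
      then have "D \<in> sets \<mu>" by (simp add: D P_def ball_measure_space[OF ball])
      then have "derivation_chart \<mu> D n x E"
        by (intro derivation_chart_subset[OF chart]) (auto simp: D P_def)
      then obtain E' where E': "derivation_chart \<mu> D n (x(l := g)) E'"
        using derivation_chart_exchange[OF _ True GL[OF g], of \<mu> D x E "1 / real (Suc i)"] by (auto simp: D P_def)
      show "covered_by_charts_in \<mu> G n D"
        by (rule Suc.IH[OF E']) (use Suc.prems(2) g in auto)
    next
      show "AE p in \<mu>. p \<in> A \<longrightarrow> p \<in> \<Union>(P ` (G \<times> UNIV))"
        using some_generator_has_nonzero_partial[OF ball chart True G]
      proof (rule eventually_mono, intro impI)
        fix p assume "p \<in> A" "p \<in> A \<longrightarrow> (\<exists>g\<in>G. E l g p \<noteq> 0)"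
        then obtain g where g: "g \<in> G" "\<bar>E l g p\<bar> > 0" by auto
        then obtain i where "1 / real (Suc i) < \<bar>E l g p\<bar>" using nat_approx_posE by blast
        then have "p \<in> P (g, i)" using \<open>p \<in> A\<close> by (simp add: P_def)
        then show "p \<in> \<Union>(P ` (G \<times> UNIV))" using g(1) by blast
      qed
    qed
  qed
qed

section \<open>Measurable differentiable structures\<close>

lemma AE_restrict_iff:
  "A \<in> sets \<mu> \<Longrightarrow> (AE p in restrict_space \<mu> A. P p) \<longleftrightarrow> (AE p in \<mu>. p \<in> A \<longrightarrow> P p)"
  by (rule AE_restrict_space_iff) (simp add: sets.Int_space_eq2)

lemma partials_iff:
  assumes "A \<in> sets \<mu>"
  shows "partials \<mu> A n x f d \<longleftrightarrow> (\<forall>j<n. ess_bounded \<mu> A (\<lambda>p. indicator A p * d j p)) \<and>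
    (AE p in \<mu>. p \<in> A \<longrightarrow> flat_at (\<lambda>y. f y - (\<Sum>j<n. d j p * x j y)) p)"
  unfolding partials_def Linf_iff[OF assms] AE_restrict_iff[OF assms] pointwise_Lip_eq_0_iff ..

lemma ess_bounded_indicator:
  assumes "A \<in> sets \<mu>" "ess_bounded \<mu> A d"
  shows "ess_bounded \<mu> A (\<lambda>p. indicator A p * d p)"
proof -
  have "ess_bounded \<mu> A (indicator A)" using assms(1) by (auto simp: ess_bounded_def intro!: exI[of _ 1])
  then show ?thesis using assms(2) by (rule ess_bounded_mult)
qed

lemma chart_if_derivation_chart:
  assumes chart: "derivation_chart \<mu> A n x E"
  shows "chart \<mu> A n x"
  unfolding chart_def
proof (intro conjI allI impI)
  note A = derivation_chart_sets[OF chart]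
  show "\<exists>L. L-lipschitz_on UNIV (x j)" if "j < n" for j
    using derivation_chart_lipschitz[OF chart that] by (simp add: lipschitz_function_def)
  fix f :: "'a \<Rightarrow> real" assume "\<exists>L. L-lipschitz_on UNIV f"
  then have "lipschitz_function f" by (simp add: lipschitz_function_def)
  then obtain d where d: "\<And>j. j < n \<Longrightarrow> ess_bounded \<mu> A (d j)"
      "AE p in \<mu>. p \<in> A \<longrightarrow> flat_at (\<lambda>y. f y - (\<Sum>j<n. d j p * x j y)) p"
    using derivation_chart_exists[OF chart] by blast
  have "partials \<mu> A n x f d"
    unfolding partials_iff[OF A] using d ess_bounded_indicator[OF A] by blast
  moreover have "AE p in restrict_space \<mu> A. d' j p = d j p" if d': "partials \<mu> A n x f d'" and j: "j < n" for d' j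
  proof -
    define c where "c j p = indicator A p * d' j p + (- 1) * d j p" for j p
    have "AE p in \<mu>. p \<in> A \<longrightarrow> c j p = 0"
    proof (rule derivation_chart_unique[OF chart _ _ j])
      show "ess_bounded \<mu> A (c i)" if "i < n" for i
        unfolding c_def using d' d(1) that
        by (intro ess_bounded_add ess_bounded_mult[OF ess_bounded_const]) (auto simp: partials_iff[OF A])
      have "AE p in \<mu>. p \<in> A \<longrightarrow> flat_at (\<lambda>y. f y - (\<Sum>j<n. d' j p * x j y)) p"
        using d' by (simp add: partials_iff[OF A])
      then show "AE p in \<mu>. p \<in> A \<longrightarrow> flat_at (\<lambda>y. \<Sum>j<n. c j p * x j y) p"
        using d(2)
      proof (rule eventually_elim2, intro impI)
        fix p assume p: "p \<in> A" and "p \<in> A \<longrightarrow> flat_at (\<lambda>y. f y - (\<Sum>j<n. d' j p * x j y)) p"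
          "p \<in> A \<longrightarrow> flat_at (\<lambda>y. f y - (\<Sum>j<n. d j p * x j y)) p"
        then have "flat_at (\<lambda>y. (f y - (\<Sum>j<n. d j p * x j y)) + (- 1) * (f y - (\<Sum>j<n. d' j p * x j y))) p"
          by (intro flat_at_add flat_at_scale) auto
        moreover have "(\<Sum>j<n. c j p * x j y) = (\<Sum>j<n. d' j p * x j y) - (\<Sum>j<n. d j p * x j y)" for y
          using p by (simp add: c_def sum_subtractf[symmetric] left_diff_distrib)
        ultimately show "flat_at (\<lambda>y. \<Sum>j<n. c j p * x j y) p" by simp
      qed
    qed
    then show ?thesis unfolding AE_restrict_iff[OF A] by (rule eventually_mono) (auto simp: c_def)
  qed
  ultimately show "\<exists>d. partials \<mu> A n x f d \<and>
      (\<forall>d'. partials \<mu> A n x f d' \<longrightarrow> (\<forall>j<n. AE p in restrict_space \<mu> A. d' j p = d j p))"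
    by blast
qed

lemma restriction_in_lip_algebra:
  fixes f :: "'a::metric_space \<Rightarrow> real"
  assumes f: "f \<in> lip_algebra UNIV" and A: "A \<noteq> {}"
  shows "(\<lambda>p. indicator A p * f p) \<in> lip_algebra A"
    and "lip_norm A (\<lambda>p. indicator A p * f p) \<le> lip_norm UNIV f"
proof -
  have "(lip_norm UNIV f)-lipschitz_on A f"
    by (rule lipschitz_on_subset[OF lip_norm_lipschitz[OF f]]) auto
  then have L: "(lip_norm UNIV f)-lipschitz_on A (\<lambda>p. indicator A p * f p)"
    by (rule lipschitz_on_transform) simp
  have b: "\<bar>indicator A p * f p\<bar> \<le> lip_norm UNIV f" if "p \<in> A" for p
    using abs_le_lip_norm[OF f, of p] that by simp
  show "(\<lambda>p. indicator A p * f p) \<in> lip_algebra A" using L b by (rule lip_algebraI) auto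
  show "lip_norm A (\<lambda>p. indicator A p * f p) \<le> lip_norm UNIV f" using A L b by (rule lip_norm_le)
qed

text \<open>
  A derivation on \<open>A\<close> is composed with restriction to \<open>A\<close>, which is multiplicative, does not increase
  the norm and preserves bounded pointwise convergence.
\<close>

lemma Der_imp_local_derivation:
  assumes D: "D \<in> Der \<mu> A" and A: "A \<in> sets \<mu>" "A \<noteq> {}"
  shows "local_derivation \<mu> A (\<lambda>f p. indicator A p * D (\<lambda>q. indicator A q * f q) p)"
proof -
  let ?r = "\<lambda>f q. indicator A q * f q :: real"
  let ?R = "restrict_space \<mu> A"
  note r = restriction_in_lip_algebra[OF _ A(2)]
  have Linf: "D f \<in> Linf ?R" if "f \<in> lip_algebra A" for f using D that by (simp add: Der_def)
  have add: "AE p in \<mu>. p \<in> A \<longrightarrow> D (\<lambda>x. f x + g x) p = D f p + D g p"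
    if "f \<in> lip_algebra A" "g \<in> lip_algebra A" for f g
    using D that unfolding Der_def AE_restrict_iff[OF A(1)] by simp
  have scale: "AE p in \<mu>. p \<in> A \<longrightarrow> D (\<lambda>x. c * f x) p = c * D f p" if "f \<in> lip_algebra A" for f c
    using D that unfolding Der_def AE_restrict_iff[OF A(1)] by simp
  have mult: "AE p in \<mu>. p \<in> A \<longrightarrow> D (\<lambda>x. f x * g x) p = D f p * g p + f p * D g p"
    if "f \<in> lip_algebra A" "g \<in> lip_algebra A" for f g
    using D that unfolding Der_def AE_restrict_iff[OF A(1)] by simp
  have "\<exists>C. \<forall>f\<in>lip_algebra A. Linf_norm ?R (D f) \<le> ereal (C * lip_norm A f)"
    using D unfolding Der_def by simp
  then obtain C where C: "\<And>f. f \<in> lip_algebra A \<Longrightarrow> Linf_norm ?R (D f) \<le> ereal (C * lip_norm A f)" by blast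
  have cont: "Linf_weak_star_lim ?R (\<lambda>n. D (fs n)) (D f)"
    if "\<And>n. fs n \<in> lip_algebra A" "limitin (lip_weak_star A) fs f sequentially" for fs f
    using D that unfolding Der_def by simp
  show ?thesis unfolding local_derivation_def
  proof (intro conjI ballI allI impI)
    fix f :: "'a \<Rightarrow> real" assume f: "f \<in> lip_algebra UNIV"
    show "(\<lambda>p. indicator A p * D (?r f) p) \<in> borel_measurable \<mu>"
      using Linf[OF r(1)[OF f]] unfolding Linf_iff[OF A(1)] by (rule ess_boundedD)
    show "AE p in \<mu>. p \<in> A \<longrightarrow> indicator A p * D (?r (\<lambda>x. c * f x)) p = c * (indicator A p * D (?r f) p)" for c
    proof -
      have "?r (\<lambda>x. c * f x) = (\<lambda>x. c * ?r f x)" by (simp add: mult.left_commute)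
      then show ?thesis using scale[OF r(1)[OF f], of c] by (auto elim: eventually_mono)
    qed
    fix g :: "'a \<Rightarrow> real" assume g: "g \<in> lip_algebra UNIV"
    show "AE p in \<mu>. p \<in> A \<longrightarrow> indicator A p * D (?r (\<lambda>x. f x + g x)) p =
        indicator A p * D (?r f) p + indicator A p * D (?r g) p"
    proof -
      have "?r (\<lambda>x. f x + g x) = (\<lambda>x. ?r f x + ?r g x)" by (simp add: distrib_left)
      then show ?thesis using add[OF r(1)[OF f] r(1)[OF g]] by (auto elim: eventually_mono)
    qed
    show "AE p in \<mu>. p \<in> A \<longrightarrow> indicator A p * D (?r (\<lambda>x. f x * g x)) p =
        indicator A p * D (?r f) p * g p + f p * (indicator A p * D (?r g) p)"
    proof -
      have "?r (\<lambda>x. f x * g x) = (\<lambda>x. ?r f x * ?r g x)" by (auto simp: indicator_def)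
      then show ?thesis using mult[OF r(1)[OF f] r(1)[OF g]] by (auto elim!: eventually_mono)
    qed
  next
    have "AE p in \<mu>. p \<in> A \<longrightarrow> \<bar>indicator A p * D (?r f) p\<bar> \<le> \<bar>C\<bar> * lip_norm UNIV f"
      if f: "f \<in> lip_algebra UNIV" for f
    proof -
      have "C * lip_norm A (?r f) \<le> \<bar>C\<bar> * lip_norm A (?r f)"
        by (rule mult_right_mono) (use lip_norm_nonneg[OF r(1)[OF f] A(2)] in auto)
      also have "\<dots> \<le> \<bar>C\<bar> * lip_norm UNIV f" by (rule mult_left_mono[OF r(2)[OF f]]) simp
      finally have le: "ereal (C * lip_norm A (?r f)) \<le> ereal (\<bar>C\<bar> * lip_norm UNIV f)" by simp
      have "AE p in ?R. ereal \<bar>D (?r f) p\<bar> \<le> Linf_norm ?R (D (?r f))" unfolding Linf_norm_def by (rule esssup_AE)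
      then have "AE p in ?R. ereal \<bar>D (?r f) p\<bar> \<le> ereal (\<bar>C\<bar> * lip_norm UNIV f)"
        by (rule eventually_mono) (use C[OF r(1)[OF f]] le in order)
      then show ?thesis unfolding AE_restrict_iff[OF A(1)] by (rule eventually_mono) simp
    qed
    then show "\<exists>C\<ge>0. \<forall>f\<in>lip_algebra UNIV. AE p in \<mu>. p \<in> A \<longrightarrow> \<bar>indicator A p * D (?r f) p\<bar> \<le> C * lip_norm UNIV f"
      by (intro exI[of _ "\<bar>C\<bar>"]) auto
  next
    fix fs :: "nat \<Rightarrow> 'a \<Rightarrow> real" and K and h :: "'a \<Rightarrow> real"
    assume H: "(\<forall>n. fs n \<in> lip_algebra UNIV \<and> lip_norm UNIV (fs n) \<le> K) \<and> (\<forall>p. (\<lambda>n. fs n p) \<longlonglongrightarrow> 0) \<and>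
      integrable \<mu> h \<and> (\<forall>p. p \<notin> A \<longrightarrow> h p = 0)"
    then have fs: "\<And>n. fs n \<in> lip_algebra UNIV" and h: "integrable \<mu> h" "\<And>p. p \<notin> A \<Longrightarrow> h p = 0" by auto
    let ?z = "?r (\<lambda>_. 0)"
    have z: "?z \<in> lip_algebra A" by (rule r(1)[OF lip_algebra_const])
    \<comment> \<open>Only here does the weak* topology of \<open>lip_algebra A\<close> enter; bounded pointwise convergence is
      what both notions of continuity have in common.\<close>
    have "limitin (lip_weak_star A) (\<lambda>n. ?r (fs n)) ?z sequentially"
    proof (rule limitin_lip_weak_star[OF A(2)])
      show "?r (fs n) \<in> lip_algebra A" for n by (rule r(1)[OF fs])
      show "lip_norm A (?r (fs n)) \<le> K" for n using r(2)[OF fs, of n] H by (meson order_trans)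
      show "(\<lambda>n. ?r (fs n) p) \<longlonglongrightarrow> ?z p" if "p \<in> A" for p using H that by simp
    qed (rule z)
    then have "Linf_weak_star_lim ?R (\<lambda>n. D (?r (fs n))) (D ?z)" by (rule cont[OF r(1)[OF fs]])
    moreover have h_eq: "indicator A p *\<^sub>R h p = h p" for p using h(2)[of p] by (cases "p \<in> A") simp_all
    then have "integrable ?R h" using h(1) A(1) by (subst integrable_restrict_space) (simp_all only: sets.Int_space_eq2)
    ultimately have lim: "(\<lambda>n. \<integral>p. D (?r (fs n)) p * h p \<partial>?R) \<longlonglongrightarrow> (\<integral>p. D ?z p * h p \<partial>?R)"
      unfolding Linf_weak_star_lim_def by blast
    have "AE p in \<mu>. p \<in> A \<longrightarrow> D ?z p = 0" using scale[OF z, of 0] by simp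
    then have "AE p in ?R. D ?z p * h p = 0"
      unfolding AE_restrict_iff[OF A(1)] by (rule eventually_mono) simp
    then have "(\<integral>p. D ?z p * h p \<partial>?R) = 0" by (rule integral_eq_zero_AE)
    moreover have "(\<integral>p. u p * h p \<partial>?R) = (\<integral>p. indicator A p * u p * h p \<partial>\<mu>)" for u
      using A(1) by (subst integral_restrict_space) (auto simp: mult.assoc)
    ultimately show "(\<lambda>n. \<integral>p. indicator A p * D (?r (fs n)) p * h p \<partial>\<mu>) \<longlonglongrightarrow> 0"
      using lim by simp
  qed
qed

text \<open>
  Every bounded Lipschitz function on the whole space is an extension of its own restriction to \<open>A\<close>,
  so that the given derivations, applied to the restriction, yield its partial derivatives.
\<close>

lemma derivation_chart_if_partials_are_derivations:
  assumes A: "A \<in> sets \<mu>" "A \<noteq> {}" and chart: "chart \<mu> A n x"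
    and der: "partials_are_derivations \<mu> A n x"
  shows "\<exists>E. derivation_chart \<mu> A n x E"
proof -
  obtain D where D: "\<And>f F. f \<in> lip_algebra A \<Longrightarrow> \<exists>L. L-lipschitz_on UNIV F \<Longrightarrow> (\<And>p. p \<in> A \<Longrightarrow> F p = f p) \<Longrightarrow>
       partials \<mu> A n x F (\<lambda>j. D j f)" "\<And>j. j < n \<Longrightarrow> D j \<in> Der \<mu> A"
    using der unfolding partials_are_derivations_def by blast
  have lip: "\<exists>L. L-lipschitz_on UNIV (x j)" if "j < n" for j using chart that by (simp add: chart_def)
  have ex: "\<exists>d. partials \<mu> A n x f d \<and>
      (\<forall>d'. partials \<mu> A n x f d' \<longrightarrow> (\<forall>j<n. AE p in restrict_space \<mu> A. d' j p = d j p))"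
    if "\<exists>L. L-lipschitz_on UNIV f" for f using chart that by (simp add: chart_def)
  let ?E = "\<lambda>j f p. indicator A p * D j (\<lambda>q. indicator A q * f q) p"
  have "derivation_chart \<mu> A n x ?E"
    unfolding derivation_chart_def
  proof (intro conjI allI impI ballI)
    show "lipschitz_function (x j)" if "j < n" for j using lip[OF that] by (simp add: lipschitz_function_def)
    show "local_derivation \<mu> A (?E j)" if "j < n" for j
      by (rule Der_imp_local_derivation[OF D(2)[OF that] A])
  next
    fix f :: "'a \<Rightarrow> real" assume "lipschitz_function f"
    then obtain d where d: "partials \<mu> A n x f d" using ex[of f] by (auto simp: lipschitz_function_def)
    then show "\<exists>d. (\<forall>j<n. ess_bounded \<mu> A (d j)) \<and>
        (AE p in \<mu>. p \<in> A \<longrightarrow> flat_at (\<lambda>y. f y - (\<Sum>j<n. d j p * x j y)) p)"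
      unfolding partials_iff[OF A(1)]
      by (intro exI[of _ "\<lambda>j p. indicator A p * d j p"]) (auto elim!: eventually_mono)
  next
    fix d j assume d: "(\<forall>j<n. ess_bounded \<mu> A (d j)) \<and>
        (AE p in \<mu>. p \<in> A \<longrightarrow> flat_at (\<lambda>y. \<Sum>j<n. d j p * x j y) p)" and j: "j < n"
    let ?zero = "\<lambda>_::'a. 0 :: real"
    have "\<exists>L. L-lipschitz_on UNIV ?zero" using lipschitz_on_constant by blast
    then obtain e where e: "\<And>d'. partials \<mu> A n x ?zero d' \<Longrightarrow> AE p in \<mu>. p \<in> A \<longrightarrow> d' j p = e j p"
      using ex[of ?zero] j unfolding AE_restrict_iff[OF A(1)] by blast
    have "AE p in \<mu>. p \<in> A \<longrightarrow> flat_at (\<lambda>y. ?zero y - (\<Sum>j<n. d j p * x j y)) p"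
    proof -
      have "AE p in \<mu>. p \<in> A \<longrightarrow> flat_at (\<lambda>y. \<Sum>j<n. d j p * x j y) p" using d by simp
      then show ?thesis
      proof (rule eventually_mono, intro impI)
        fix p assume "p \<in> A" "p \<in> A \<longrightarrow> flat_at (\<lambda>y. \<Sum>j<n. d j p * x j y) p"
        then have "flat_at (\<lambda>y. (- 1) * (\<Sum>j<n. d j p * x j y)) p" by (intro flat_at_scale) auto
        then show "flat_at (\<lambda>y. ?zero y - (\<Sum>j<n. d j p * x j y)) p" by simp
      qed
    qed
    then have "partials \<mu> A n x ?zero d" using d ess_bounded_indicator[OF A(1)] by (simp add: partials_iff[OF A(1)])
    moreover have "partials \<mu> A n x ?zero (\<lambda>_. ?zero)"
      by (simp add: partials_iff[OF A(1)] ess_bounded_const flat_at_zero)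
    ultimately have "AE p in \<mu>. p \<in> A \<longrightarrow> d j p = e j p" "AE p in \<mu>. p \<in> A \<longrightarrow> ?zero p = e j p"
      using e by blast+
    then show "AE p in \<mu>. p \<in> A \<longrightarrow> d j p = 0" by eventually_elim simp
  next
    fix f :: "'a \<Rightarrow> real" assume f: "f \<in> lip_algebra UNIV"
    have "partials \<mu> A n x f (\<lambda>j. D j (\<lambda>q. indicator A q * f q))"
      using f by (intro D(1) restriction_in_lip_algebra A) (auto simp: lip_algebra_def)
    then have "AE p in \<mu>. p \<in> A \<longrightarrow> flat_at (\<lambda>y. f y - (\<Sum>j<n. D j (\<lambda>q. indicator A q * f q) p * x j y)) p"
      by (simp add: partials_iff[OF A(1)])
    then show "AE p in \<mu>. p \<in> A \<longrightarrow> flat_at (\<lambda>y. f y - (\<Sum>j<n. ?E j f p * x j y)) p"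
      by (rule eventually_mono) simp
  qed (rule A(1))
  then show ?thesis by blast
qed

lemma measurable_diff_structure_from_cover:
  assumes ball: "ball_measure \<mu>"
    and \<C>: "countable \<C>" "\<And>C. C \<in> \<C> \<Longrightarrow> \<exists>n\<le>b. has_chart_in \<mu> G n C" and cover: "AE p in \<mu>. p \<in> \<Union>\<C>"
  shows "\<exists>I X N x. measurable_diff_structure \<mu> I X N x \<and> (\<forall>\<alpha>\<in>I. \<forall>j<N \<alpha>. x \<alpha> j \<in> G)"
proof (cases "\<C> = {}")
  case True
  then have "UNIV \<in> null_sets \<mu>"
    using cover sets.top[of \<mu>] ball_measure_space[OF ball] by (subst AE_iff_null_sets) (auto elim: eventually_mono)
  then have "measurable_diff_structure \<mu> {} X N x" for X N x
    by (simp add: measurable_diff_structure_def disjoint_family_on_def)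
  then show ?thesis by blast
next
  case False
  define C where "C = from_nat_into \<C>"
  have C: "C i \<in> \<C>" for i using False by (simp add: C_def from_nat_into)
  have range: "range C = \<C>" using False \<C>(1) by (simp add: C_def)
  have "\<forall>i. \<exists>n x E. n \<le> b \<and> derivation_chart \<mu> (C i) n x E \<and> (\<forall>j<n. x j \<in> G)"
    using \<C>(2)[OF C] by (auto simp: has_chart_in_def)
  then obtain N x E where chart: "\<And>i. N i \<le> b" "\<And>i. derivation_chart \<mu> (C i) (N i) (x i) (E i)"
      "\<And>i j. j < N i \<Longrightarrow> x i j \<in> G" by metis
  have sets: "C i \<in> sets \<mu>" for i using derivation_chart_sets[OF chart(2)] .
  have X: "disjointed C i \<in> sets \<mu>" for i
    using sets.range_disjointed_sets[of C \<mu>] sets by blast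
  have "chart \<mu> (disjointed C i) (N i) (x i)" for i
    by (rule chart_if_derivation_chart[OF derivation_chart_subset[OF chart(2) disjointed_subset X]])
  moreover have "UNIV - (\<Union>i. disjointed C i) \<in> null_sets \<mu>"
  proof -
    have U: "(\<Union>i. disjointed C i) = \<Union>\<C>" using range by (simp add: UN_disjointed_eq)
    have "UNIV - (\<Union>i. disjointed C i) \<in> sets \<mu>" using X sets.compl_sets[of _ \<mu>] by (auto simp: ball_measure_space[OF ball])
    then show ?thesis using cover unfolding U[symmetric] by (subst AE_iff_null_sets) (auto elim!: eventually_mono)
  qed
  ultimately have "measurable_diff_structure \<mu> UNIV (disjointed C) N x"
    unfolding measurable_diff_structure_def using X chart(1) disjoint_family_disjointed[of C] by blast
  then show ?thesis using chart(3) by blast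
qed

theorem theorem6p28:
  fixes \<mu> :: "'a::metric_space measure"
    and I :: "nat set" and X :: "nat \<Rightarrow> 'a set" and N :: "nat \<Rightarrow> nat"
    and x :: "nat \<Rightarrow> nat \<Rightarrow> 'a \<Rightarrow> real"
    and M :: enat and g :: "nat \<Rightarrow> 'a \<Rightarrow> real"
  assumes "doubling_measure \<mu>"
    and "measurable_diff_structure \<mu> I X N x"
    and "\<And>\<alpha>. \<alpha> \<in> I \<Longrightarrow> emeasure \<mu> (X \<alpha>) > 0 \<Longrightarrow>
           partials_are_derivations \<mu> (X \<alpha>) (N \<alpha>) (x \<alpha>)"
    and "generating_set (g ` {j. 1 \<le> j \<and> enat j \<le> M})"
  shows "\<exists>I' X' N' x'. measurable_diff_structure \<mu> I' X' N' x' \<and>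
           (\<forall>\<alpha>\<in>I'. \<forall>j<N' \<alpha>. x' \<alpha> j \<in> g ` {j. 1 \<le> j \<and> enat j \<le> M})"
proof -
  have ball: "ball_measure \<mu>" by (rule doubling_imp_ball_measure[OF assms(1)])
  let ?G = "g ` {j. 1 \<le> j \<and> enat j \<le> M}"
  have G: "countable ?G" by simp
  have sets: "X \<alpha> \<in> sets \<mu>" if "\<alpha> \<in> I" for \<alpha> using assms(2) that by (simp add: measurable_diff_structure_def)
  have chart: "chart \<mu> (X \<alpha>) (N \<alpha>) (x \<alpha>)" if "\<alpha> \<in> I" for \<alpha>
    using assms(2) that by (simp add: measurable_diff_structure_def)
  obtain b where b: "\<And>\<alpha>. \<alpha> \<in> I \<Longrightarrow> N \<alpha> \<le> b" using assms(2) by (auto simp: measurable_diff_structure_def)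
  have "covered_by_charts_in \<mu> ?G (N \<alpha>) (X \<alpha>)" if \<alpha>: "\<alpha> \<in> I" for \<alpha>
  proof (cases "emeasure \<mu> (X \<alpha>) > 0")
    case True
    then have "X \<alpha> \<noteq> {}" by auto
    then obtain E where "derivation_chart \<mu> (X \<alpha>) (N \<alpha>) (x \<alpha>) E"
      using derivation_chart_if_partials_are_derivations[OF sets[OF \<alpha>] _ chart[OF \<alpha>] assms(3)[OF \<alpha> True]] by blast
    then show ?thesis
      by (rule chart_covered_by_charts_in_generators[OF ball assms(4) G, where l = "N \<alpha>"]) simp
  next
    case False
    then have "X \<alpha> \<in> null_sets \<mu>" using sets[OF \<alpha>] by (simp add: null_sets_def)
    then have "AE p in \<mu>. p \<notin> X \<alpha>" by (rule AE_not_in)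
    then show ?thesis unfolding covered_by_charts_in_def by (intro exI[of _ "{}"]) simp
  qed
  then have "\<forall>\<alpha>\<in>I. \<exists>\<C>. countable \<C> \<and> (\<forall>C\<in>\<C>. has_chart_in \<mu> ?G (N \<alpha>) C) \<and> (AE p in \<mu>. p \<in> X \<alpha> \<longrightarrow> p \<in> \<Union>\<C>)"
    by (simp add: covered_by_charts_in_def)
  then obtain \<C> where "\<forall>\<alpha>\<in>I. countable (\<C> \<alpha>) \<and> (\<forall>C\<in>\<C> \<alpha>. has_chart_in \<mu> ?G (N \<alpha>) C) \<and>
      (AE p in \<mu>. p \<in> X \<alpha> \<longrightarrow> p \<in> \<Union>(\<C> \<alpha>))"
    by (rule bchoice[THEN exE])
  then have \<C>: "\<And>\<alpha>. \<alpha> \<in> I \<Longrightarrow> countable (\<C> \<alpha>)"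
      "\<And>\<alpha> C. \<alpha> \<in> I \<Longrightarrow> C \<in> \<C> \<alpha> \<Longrightarrow> has_chart_in \<mu> ?G (N \<alpha>) C"
      "\<And>\<alpha>. \<alpha> \<in> I \<Longrightarrow> AE p in \<mu>. p \<in> X \<alpha> \<longrightarrow> p \<in> \<Union>(\<C> \<alpha>)"
    by simp_all
  show ?thesis
  proof (rule measurable_diff_structure_from_cover[OF ball])
    show "countable (\<Union>\<alpha>\<in>I. \<C> \<alpha>)" using \<C>(1) by (intro countable_UN) auto
    show "\<exists>n\<le>b. has_chart_in \<mu> ?G n C" if "C \<in> (\<Union>\<alpha>\<in>I. \<C> \<alpha>)" for C using that b \<C>(2) by blast
    have "UNIV - (\<Union>\<alpha>\<in>I. X \<alpha>) \<in> null_sets \<mu>" using assms(2) by (simp add: measurable_diff_structure_def)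
    then have "AE p in \<mu>. p \<notin> UNIV - (\<Union>\<alpha>\<in>I. X \<alpha>)" by (rule AE_not_in)
    moreover have "AE p in \<mu>. \<forall>\<alpha>\<in>I. p \<in> X \<alpha> \<longrightarrow> p \<in> \<Union>(\<C> \<alpha>)"
      using \<C>(3) by (rule AE_ball_countable') auto
    ultimately show "AE p in \<mu>. p \<in> \<Union>(\<Union>\<alpha>\<in>I. \<C> \<alpha>)" by eventually_elim blast
  qed
qed

end
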